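(* Let $C\subseteq[0,1]$ be the fat Cantor set $C=\bigcap_{n=0}^\infty C_n$, where $C_0=[0,1]$ and, for $n\ge1$, $C_n$ is obtained from $C_{n-1}$ by removing from the middle of each maximal subinterval of $C_{n-1}$ a centered open interval so that $C_n$ is the union of $2^n$ disjoint closed intervals, each of length $l_n=\frac{1}{2^{n+1}-1}$. Then $F=C\times C\subseteq\mathbb{R}^2$ admits phase transition. Notably, for $0<\alpha<\frac12$ we have $D_*(\alpha,F)=0$, while for $\frac12<\alpha\le1$ we have $D_*(\alpha,F)=1$.
   Context: For $F\subseteq\mathbb{R}^p$, $c>0$ and $0<\alpha\le1$, a function $f:F\to\mathbb{R}$ is $c$-Hölder-$\alpha$ if $|f(x)-f(y)|\le c|x-y|^\alpha$ for all $x,y\in F$. $C_1^\alpha(F)$ denotes the set of 1-Hölder-$\alpha$ functions on $F$, with the metric given by the supremum norm. For $f:F\to\mathbb{R}$ put $D^f(r,F)=\dim_H(f^{-1}(r))$ (Hausdorff dimension, with $\dim_H\emptyset=0$ here) and $$D_*^f(F)=\sup\{d\ge0:\lambda\{r\in\mathbb{R}: D^f(r,F)\ge d\}>0\},$$ where $\lambda$ is one-dimensional Lebesgue measure. Let $\mathfrak{G}_{1,\alpha}(F)$ be the collection of all dense $G_\delta$ subsets of $C_1^\alpha(F)$, and for $0<\alpha\le 1$ define $$D_*(\alpha,F)=\sup_{\mathcal{G}\in\mathfrak{G}_{1,\alpha}(F)}\ \inf\{D_*^f(F): f\in\mathcal{G}\}.$$ For $\alpha=0$ define $D_*(0,F)=\max\{0,\dim_{tH}F-1\}$,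 where $\dim_{tH}$ is the topological Hausdorff dimension: $\dim_{tH}\emptyset=-1$, and for a nonempty metric space $X$, $\dim_{tH}X=\inf\{d: X \text{ has a basis } \mathcal{U} \text{ of open sets such that } \dim_H\partial U\le d-1 \text{ for every } U\in\mathcal{U}\}$, with the convention $\dim_H\emptyset=-1$ in this definition. We say that $F$ admits phase transition (there is a phase transition for $D_*(\alpha,F)$) if there exists $0<\alpha_\varphi<1$ such that $D_*(\alpha,F)=D_*(0,F)$ for all $\alpha\in[0,\alpha_\varphi)$, while $D_*(\alpha,F)>D_*(0,F)$ for all $\alpha\in(\alpha_\varphi,1]$. *)

theory Defs
  imports "HOL-Analysis.Analysis"
begin

section \<open>Hausdorff dimension\<close>

text \<open>
  The power \<open>|U|\<^sup>s\<close> of the diameter of a covering set. The case \<open>s = 0\<close> is treated separately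
  because \<open>0 powr 0 = 0\<close>, whereas a nonempty set has to contribute \<open>|U|\<^sup>0 = 1\<close>.
\<close>

definition diam_pow :: "real \<Rightarrow> 'a::metric_space set \<Rightarrow> ennreal" where
  "diam_pow s U =
     (if U = {} then 0 else if s = 0 then 1 else ennreal (diameter U powr s))"

text \<open>
  Finite covers are included: pad them with empty sets. Boundedness is required explicitly
  because \<^const>\<open>diameter\<close> is unspecified on unbounded sets.
\<close>

definition hausdorff_premeasure :: "real \<Rightarrow> real \<Rightarrow> 'a::metric_space set \<Rightarrow> ennreal" where
  "hausdorff_premeasure \<delta> s A =
     (INF U \<in> {U :: nat \<Rightarrow> 'a set.
                 A \<subseteq> (\<Union>i. U i) \<and> (\<forall>i. bounded (U i) \<and> diameter (U i) \<le> \<delta>)}.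
        (\<Sum>i. diam_pow s (U i)))"

definition hausdorff_measure :: "real \<Rightarrow> 'a::metric_space set \<Rightarrow> ennreal" where
  "hausdorff_measure s A = (SUP \<delta> \<in> {0<..}. hausdorff_premeasure \<delta> s A)"

text \<open>With this definition the empty set has dimension \<open>0\<close>.\<close>

definition hausdorff_dim :: "'a::metric_space set \<Rightarrow> ereal" where
  "hausdorff_dim A = Inf {ereal s | s. 0 \<le> s \<and> hausdorff_measure s A = 0}"

section \<open>Topological Hausdorff dimension\<close>

text \<open>
  \<open>openin X = arbitrary union_of (\<lambda>U. U \<in> \<U>)\<close> says that \<open>\<U>\<close> is a basis of \<open>X\<close>: the open sets are
  exactly the unions of subfamilies of \<open>\<U>\<close>. Boundaries are taken relative to the subspace \<open>F\<close>.
  The empty set has dimension \<open>-1\<close> here, both as a space and as a boundary.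
\<close>

definition tH_dim :: "'a::metric_space set \<Rightarrow> ereal" where
  "tH_dim F =
     (if F = {} then -1
      else Inf {ereal d | d.
             \<exists>\<U>. openin (top_of_set F) = arbitrary union_of (\<lambda>U. U \<in> \<U>) \<and>
                 (\<forall>U\<in>\<U>. (let B = top_of_set F frontier_of U
                           in (if B = {} then -1 else hausdorff_dim B) \<le> ereal (d - 1)))})"

section \<open>Level sets of generic Hoelder functions\<close>

definition holder_on :: "real \<Rightarrow> real \<Rightarrow> 'a::metric_space set \<Rightarrow> ('a \<Rightarrow> real) \<Rightarrow> bool" where
  "holder_on c \<alpha> F f \<longleftrightarrow> (\<forall>x\<in>F. \<forall>y\<in>F. \<bar>f x - f y\<bar> \<le> c * dist x y powr \<alpha>)"

text \<open>
  The space of 1-Hoelder-\<open>\<alpha>\<close> functions on \<open>F\<close> with the supremum metric. A function on \<open>F\<close> is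
  represented by a total function that is \<^const>\<open>undefined\<close> outside \<open>F\<close>. The elements of
  \<^const>\<open>funspace\<close> are bounded, which is automatic for Hoelder functions on a bounded \<open>F\<close>.
\<close>

definition holder1_space :: "real \<Rightarrow> 'a::metric_space set \<Rightarrow> ('a \<Rightarrow> real) metric" where
  "holder1_space \<alpha> F = submetric (funspace F euclidean_metric) {f. holder_on 1 \<alpha> F f}"

definition dense_gdeltas :: "real \<Rightarrow> 'a::metric_space set \<Rightarrow> ('a \<Rightarrow> real) set set" where
  "dense_gdeltas \<alpha> F =
     (let X = mtopology_of (holder1_space \<alpha> F)
      in {G. gdelta_in X G \<and> X closure_of G = topspace X})"

definition level_dim :: "('a::metric_space \<Rightarrow> real) \<Rightarrow> real \<Rightarrow> 'a set \<Rightarrow> ereal" where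
  "level_dim f r F = hausdorff_dim {x \<in> F. f x = r}"

text \<open>
  Lebesgue outer measure coincides with Lebesgue measure on Lebesgue measurable sets; it avoids
  that \<^const>\<open>emeasure\<close> is \<open>0\<close> on sets that are not measurable.
\<close>

definition D_lower_fun :: "('a::metric_space \<Rightarrow> real) \<Rightarrow> 'a set \<Rightarrow> ereal" where
  "D_lower_fun f F =
     Sup {ereal d | d. 0 \<le> d \<and> outer_measure_of lebesgue {r. level_dim f r F \<ge> ereal d} > 0}"

text \<open>Only meaningful for \<open>0 \<le> \<alpha> \<le> 1\<close>.\<close>

definition D_lower :: "real \<Rightarrow> 'a::metric_space set \<Rightarrow> ereal" where
  "D_lower \<alpha> F =
     (if \<alpha> = 0 then max 0 (tH_dim F - 1)
      else (SUP G \<in> dense_gdeltas \<alpha> F. INF f \<in> G. D_lower_fun f F))"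

definition admits_phase_transition :: "'a::metric_space set \<Rightarrow> bool" where
  "admits_phase_transition F \<longleftrightarrow>
     (\<exists>a. 0 < a \<and> a < 1 \<and>
          (\<forall>\<alpha>. 0 \<le> \<alpha> \<and> \<alpha> < a \<longrightarrow> D_lower \<alpha> F = D_lower 0 F) \<and>
          (\<forall>\<alpha>. a < \<alpha> \<and> \<alpha> \<le> 1 \<longrightarrow> D_lower \<alpha> F > D_lower 0 F))"

section \<open>The fat Cantor set\<close>

definition fat_len :: "nat \<Rightarrow> real" where
  "fat_len n = 1 / (2 ^ (n + 1) - 1)"

text \<open>
  The maximal subintervals of a level are its connected components. From such an interval
  \<open>[a, b]\<close> one removes the centered open interval that leaves, on either side, a closed interval
  of length \<open>fat_len (Suc n)\<close>.
\<close>

primrec fat_cantor_level :: "nat \<Rightarrow> real set" where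
  "fat_cantor_level 0 = {0..1}"
| "fat_cantor_level (Suc n) =
     fat_cantor_level n -
       (\<Union>I \<in> components (fat_cantor_level n).
          {Inf I + fat_len (Suc n) <..< Sup I - fat_len (Suc n)})"

definition fat_cantor :: "real set" where
  "fat_cantor = (\<Inter>n. fat_cantor_level n)"

end

theory Submission
  imports Defs
begin

text \<open>
  Write \<open>l\<^sub>n\<close> for the length of the intervals of level \<open>n\<close>. The gap removed from the middle of an
  interval of length \<open>l\<^sub>n\<close> has length exactly \<open>l\<^sub>n l\<^sub>n\<^sub>+\<^sub>1\<close>, the square of the length of the interval
  up to a constant. A 1-Hoelder-\<open>\<alpha>\<close> function can therefore jump by about \<open>l\<^sub>n\<^sup>2\<^sup>\<alpha>\<close> across a gap, and
  this dominates the diameter \<open>l\<^sub>n\<close> of the adjacent squares or is dominated by it according as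
  \<open>\<alpha> < 1/2\<close> or \<open>\<alpha> > 1/2\<close>.

  For \<open>\<alpha> < 1/2\<close> the jumps leave room for making a Lipschitz function constant on each square of a
  deep level without violating the Hoelder condition (\<open>rounding_preserves_holder\<close>). Lipschitz
  functions are dense (\<open>holder_lipschitz_approximation\<close>), hence so are the functions with finite
  range, and generically the range is a null set. Almost every level set is then empty, and
  \<open>D\<^sub>*(\<alpha>, F) = 0\<close>.

  For \<open>\<alpha> > 1/2\<close> consider a row \<open>C \<times> {y}\<close>. Along it the values at \<open>0\<close> and \<open>l\<^sub>m\<close> differ by some
  amount, and the function takes every value in between except for those that it jumps over. The
  jumps across the gaps inside \<open>[0, l\<^sub>m]\<close> add up to \<open>O(l\<^sub>m\<^sup>2\<^sup>\<alpha>)\<close> (\<open>holder_image_measure\<close>), while a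
  small perturbation of any given function makes the difference at least a constant times \<open>l\<^sub>m\<close> for
  all \<open>y\<close> close to \<open>0\<close>. So for a dense open set of functions the images of all rows near \<open>y = 0\<close>
  have positive measure, and since \<open>C\<close> has positive measure too, Fubini's theorem yields a set of
  positive measure of levels whose level sets project to sets of positive length. Their dimension is
  at least \<open>1\<close> (\<open>steep_rows_D_lower_fun\<close>).

  The upper bound \<open>D\<^sub>*(\<alpha>, F) \<le> 1\<close> holds for every nonempty subset of the unit square
  (\<open>D_lower_le_1\<close>): a Lipschitz function has level sets that, on average, meet only \<open>O(N)\<close> of \<open>N\<^sup>2\<close>
  squares, and this is stable under small perturbations. Finally \<open>F\<close> has a basis of clopen sets, so
  its topological Hausdorff dimension is at most \<open>0\<close> and \<open>D\<^sub>*(0, F) = 0\<close>.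
\<close>

section \<open>The cells of the fat Cantor set\<close>

lemma fat_len_pos: "0 < fat_len n"
proof -
  have "(2::real) ^ (n + 1) > 1"
    by (rule one_less_power) auto
  then show ?thesis by (simp add: fat_len_def)
qed

lemma fat_len_0 [simp]: "fat_len 0 = 1"
  by (simp add: fat_len_def)

lemma fat_len_gap: "fat_len n - 2 * fat_len (Suc n) = fat_len n * fat_len (Suc n)"
proof -
  define q :: real where "q = 2 ^ (n + 1)"
  have q: "q > 1"
    unfolding q_def by (rule one_less_power) auto
  have "fat_len n = 1 / (q - 1)" "fat_len (Suc n) = 1 / (2 * q - 1)"
    by (simp_all add: fat_len_def q_def)
  moreover have "1 / (q - 1) - 2 * (1 / (2 * q - 1)) = 1 / (q - 1) * (1 / (2 * q - 1))"
    using q by (simp add: divide_simps)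
  ultimately show ?thesis by simp
qed

lemma fat_len_Suc_le: "2 * fat_len (Suc n) \<le> fat_len n"
  using fat_len_gap[of n] fat_len_pos[of n] fat_len_pos[of "Suc n"]
  by (smt (verit) mult_pos_pos)

lemma fat_len_add_le: "fat_len (m + k) \<le> fat_len m / 2 ^ k"
proof (induction k)
  case (Suc k)
  have "fat_len (m + Suc k) \<le> fat_len (m + k) / 2"
    using fat_len_Suc_le[of "m + k"] by simp
  also have "\<dots> \<le> fat_len m / 2 ^ k / 2"
    using Suc by (intro divide_right_mono) auto
  finally show ?case by (simp add: mult.commute)
qed simp

lemma fat_len_antimono: "m \<le> n \<Longrightarrow> fat_len n \<le> fat_len m"
  using lift_Suc_antimono_le[of fat_len]
  by (metis fat_len_Suc_le fat_len_pos add_increasing less_imp_le mult_2 order.trans order_refl)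

lemma fat_len_tendsto_0: "fat_len \<longlonglongrightarrow> 0"
proof (rule tendsto_sandwich[OF _ _ tendsto_const])
  show "\<forall>\<^sub>F n in sequentially. 0 \<le> fat_len n"
    using fat_len_pos by (simp add: less_imp_le)
  show "\<forall>\<^sub>F n in sequentially. fat_len n \<le> (1/2) ^ n"
    using fat_len_add_le[of 0] by (simp add: power_one_over field_simps)
  show "(\<lambda>n. (1/2) ^ n :: real) \<longlonglongrightarrow> 0"
    by (intro LIMSEQ_power_zero) auto
qed

text \<open>
  Each interval of level \<open>m\<close> contains \<open>2\<^sup>k\<close> intervals of level \<open>m + k\<close>, in the same relative
  position whichever interval it is; these are the distances of their left endpoints from its own.
\<close>

primrec cell_offsets :: "nat \<Rightarrow> nat \<Rightarrow> real set" where
  "cell_offsets m 0 = {0}"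
| "cell_offsets m (Suc k) =
     cell_offsets m k \<union> (\<lambda>t. t + (fat_len (m + k) - fat_len (Suc (m + k)))) ` cell_offsets m k"

abbreviation left_ends :: "nat \<Rightarrow> real set" where
  "left_ends n \<equiv> cell_offsets 0 n"

lemma finite_cell_offsets [simp]: "finite (cell_offsets m k)"
  by (induction k) auto

lemma card_cell_offsets: "card (cell_offsets m k) \<le> 2 ^ k"
proof (induction k)
  case (Suc k)
  have "card (cell_offsets m (Suc k)) \<le> card (cell_offsets m k) + card (cell_offsets m k)"
    by (simp add: order.trans[OF card_Un_le] card_image_le)
  with Suc show ?case by simp
qed simp

lemma zero_in_cell_offsets [simp]: "0 \<in> cell_offsets m k"
  by (induction k) auto

lemma cell_offsets_mono: "k \<le> k' \<Longrightarrow> cell_offsets m k \<subseteq> cell_offsets m k'"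
  by (rule lift_Suc_mono_le[of "cell_offsets m"]) auto

lemma cell_offsets_subset_left_ends: "cell_offsets m k \<subseteq> left_ends (m + k)"
  by (induction k) auto

lemma cell_offsets_bounds: "t \<in> cell_offsets m k \<Longrightarrow> 0 \<le> t \<and> t + fat_len (m + k) \<le> fat_len m"
proof (induction k arbitrary: t)
  case (Suc k)
  then consider "t \<in> cell_offsets m k"
    | s where "s \<in> cell_offsets m k" "t = s + (fat_len (m + k) - fat_len (Suc (m + k)))"
    by auto
  then show ?case
    by cases (use Suc.IH fat_len_Suc_le[of "m + k"] fat_len_pos[of "Suc (m + k)"] in fastforce)+
qed simp

text \<open>
  Two intervals of level \<open>n\<close> are separated by one of the gaps of the levels up to \<open>n\<close>, and
  these have lengths \<open>l\<^sub>k l\<^sub>k\<^sub>+\<^sub>1\<close> with \<open>k < n\<close>. That the gaps are of the order of the square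
  of the length of the intervals is what puts the critical exponent at \<open>1/2\<close>.
\<close>

lemma left_ends_separated:
  assumes "s \<in> left_ends n" "t \<in> left_ends n" "s < t"
  shows "s + fat_len n + (fat_len n)\<^sup>2 \<le> t"
  using assms
proof (induction n arbitrary: s t)
  case (Suc n)
  define d where "d = fat_len n - fat_len (Suc n)"
  have d: "d = fat_len (Suc n) + fat_len n * fat_len (Suc n)"
    using fat_len_gap[of n] by (simp add: d_def)
  have le: "fat_len (Suc n) \<le> fat_len n" "0 < fat_len (Suc n)"
    using fat_len_antimono[of n "Suc n"] fat_len_pos by auto
  have sq: "(fat_len (Suc n))\<^sup>2 \<le> fat_len n * fat_len (Suc n)" "(fat_len (Suc n))\<^sup>2 \<le> (fat_len n)\<^sup>2"
    using le by (auto simp: power2_eq_square intro!: mult_mono)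
  have d0: "d > 0"
    using le by (simp add: d add_pos_pos)
  obtain s' t' where st: "s' \<in> left_ends n" "s = s' \<or> s = s' + d"
      "t' \<in> left_ends n" "t = t' \<or> t = t' + d"
    using Suc.prems(1,2) unfolding d_def by auto
  have sep: "u + fat_len n + (fat_len n)\<^sup>2 \<le> v" if "u < v" "u \<in> left_ends n" "v \<in> left_ends n" for u v
    using Suc.IH that by blast
  show ?case
  proof (cases s' t' rule: linorder_cases)
    case less
    then have "s' + fat_len n + (fat_len n)\<^sup>2 \<le> t'"
      using st sep by blast
    then show ?thesis
      using st(2,4) le sq d0 d_def by (elim disjE) linarith+
  next
    case equal
    then show ?thesis
      using st \<open>s < t\<close> sq d0 d by auto
  next
    case greater
    then have "t' + fat_len n + (fat_len n)\<^sup>2 \<le> s'"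
      using st sep by blast
    then show ?thesis
      using st \<open>s < t\<close> le d0 unfolding d_def by (smt (verit) zero_le_power2)
  qed
qed simp

lemma left_ends_separated_less:
  "s \<in> left_ends n \<Longrightarrow> t \<in> left_ends n \<Longrightarrow> s < t \<Longrightarrow> s + fat_len n < t"
  using left_ends_separated[of s n t] fat_len_pos[of n] by (smt (verit) zero_less_power)

lemma components_disjoint_intervals:
  fixes T :: "real set"
  assumes "finite T" "0 \<le> l" and sep: "\<And>s t. s \<in> T \<Longrightarrow> t \<in> T \<Longrightarrow> s < t \<Longrightarrow> s + l < t"
  shows "components (\<Union>t\<in>T. {t..t + l}) = (\<lambda>t. {t..t + l}) ` T"
proof -
  let ?S = "\<Union>t\<in>T. {t..t + l}"
  have disj: "{s..s + l} \<inter> {t..t + l} = {}" if "s \<in> T" "t \<in> T" "s \<noteq> t" for s t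
    using sep[of s t] sep[of t s] that by (cases "s < t") auto
  have comp: "connected_component_set ?S x = {t..t + l}" if "t \<in> T" "x \<in> {t..t + l}" for x t
  proof (rule connected_component_unique)
    show "x \<in> {t..t + l}" "{t..t + l} \<subseteq> ?S" "connected {t..t + l}"
      using that by auto
    fix c assume c: "x \<in> c" "c \<subseteq> ?S" "connected c"
    let ?R = "\<Union>s\<in>T - {t}. {s..s + l}"
    have "closed ?R"
      using assms(1) by auto
    moreover have "c \<subseteq> {t..t + l} \<union> ?R" "{t..t + l} \<inter> ?R \<inter> c = {}"
      using c(2) disj[OF that(1)] by blast+
    ultimately have "c \<inter> ?R = {}"
      using connected_closedD[OF c(3), of "{t..t + l}" ?R] that c(1) by auto
    with c(2) show "c \<subseteq> {t..t + l}" by auto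
  qed
  show ?thesis
  proof
    show "components ?S \<subseteq> (\<lambda>t. {t..t + l}) ` T"
      using comp by (auto simp: components_iff)
    show "(\<lambda>t. {t..t + l}) ` T \<subseteq> components ?S"
    proof safe
      fix t assume "t \<in> T"
      then show "{t..t + l} \<in> components ?S"
        using comp[of t t] assms(2) unfolding components_iff by force
    qed
  qed
qed

lemma fat_cantor_level_eq: "fat_cantor_level n = (\<Union>t\<in>left_ends n. {t..t + fat_len n})"
proof (induction n)
  case (Suc n)
  define l l' where "l = fat_len n" and "l' = fat_len (Suc n)"
  have l: "0 < l" "0 < l'" "2 * l' < l"
    using fat_len_gap[of n] fat_len_pos[of n] fat_len_pos[of "Suc n"]
    unfolding l_def l'_def by (smt (verit) mult_pos_pos)+
  have sep: "s + l < t" if "s \<in> left_ends n" "t \<in> left_ends n" "s < t" for s t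
    using left_ends_separated_less that by (simp add: l_def)
  have "components (fat_cantor_level n) = (\<lambda>t. {t..t + l}) ` left_ends n"
    unfolding Suc l_def[symmetric] using sep l by (intro components_disjoint_intervals) auto
  then have "fat_cantor_level (Suc n) =
      (\<Union>t\<in>left_ends n. {t..t + l}) - (\<Union>t\<in>left_ends n. {t + l'<..<t + l - l'})"
    using l by (simp add: Suc l_def[symmetric] l'_def[symmetric])
  also have "\<dots> = (\<Union>t\<in>left_ends n. {t..t + l} - {t + l'<..<t + l - l'})"
  proof (intro equalityI subsetI)
    fix x assume "x \<in> (\<Union>t\<in>left_ends n. {t..t + l} - {t + l'<..<t + l - l'})"
    then obtain t where t: "t \<in> left_ends n" "x \<in> {t..t + l}" "x \<notin> {t + l'<..<t + l - l'}"
      by blast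
    have "x \<notin> {s + l'<..<s + l - l'}" if "s \<in> left_ends n" for s
      using t that sep[of s t] sep[of t s] l by (cases s t rule: linorder_cases) auto
    with t show "x \<in> (\<Union>t\<in>left_ends n. {t..t + l}) - (\<Union>t\<in>left_ends n. {t + l'<..<t + l - l'})"
      by auto
  qed auto
  also have "\<dots> = (\<Union>t\<in>left_ends n. {t..t + l'} \<union> {t + (l - l')..t + (l - l') + l'})"
    using l by (intro SUP_cong refl) auto
  also have "\<dots> = (\<Union>t\<in>left_ends (Suc n). {t..t + l'})"
    by (auto simp: l_def l'_def)
  finally show ?case by (simp add: l'_def)
qed simp

lemma fat_cantor_level_antimono: "m \<le> n \<Longrightarrow> fat_cantor_level n \<subseteq> fat_cantor_level m"
  by (rule lift_Suc_antimono_le[of fat_cantor_level]) auto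

lemma compact_fat_cantor: "compact fat_cantor"
proof -
  have "compact (fat_cantor_level n)" for n
    by (simp add: fat_cantor_level_eq compact_UN)
  then show ?thesis
    unfolding fat_cantor_def by (intro compact_Inter) auto
qed

lemma fat_cantor_subset: "fat_cantor \<subseteq> {0..1}"
  unfolding fat_cantor_def using fat_cantor_level.simps(1) by blast

lemma fat_cantor_cell_ends:
  assumes "t \<in> left_ends n"
  shows "t \<in> fat_cantor" "t + fat_len n \<in> fat_cantor"
proof -
  have mem: "{t, t + fat_len n} \<subseteq> fat_cantor_level k" if "n \<le> k" for k
    using that
  proof (induction k rule: dec_induct)
    case base
    then show ?case
      using assms fat_len_pos[of n] by (auto simp: fat_cantor_level_eq intro!: bexI[of _ t])
  next
    case (step k)
    have "t \<in> left_ends (Suc k)"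
      using assms cell_offsets_mono[of n "Suc k" 0] step by auto
    moreover have "\<exists>s\<in>left_ends k. t + fat_len n = s + fat_len k" if "n \<le> k" for k
      using that
    proof (induction k rule: dec_induct)
      case (step k)
      then obtain s where "s \<in> left_ends k" "t + fat_len n = s + fat_len k"
        by blast
      then show ?case
        by (intro bexI[of _ "s + (fat_len k - fat_len (Suc k))"]) auto
    qed (use assms in auto)
    then have "\<exists>s\<in>left_ends (Suc k). t + fat_len n = s + fat_len (Suc k)"
      using step(1) by (meson le_Suc_eq)
    then obtain s where "s \<in> left_ends (Suc k)" "t + fat_len n = s + fat_len (Suc k)" ..
    ultimately show ?case
      using fat_len_pos[of "Suc k"] unfolding fat_cantor_level_eq
      by (auto simp del: cell_offsets.simps intro: bexI[of _ s] bexI[of _ t])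
  qed
  have "{t, t + fat_len n} \<subseteq> fat_cantor_level k" for k
    using mem[of "max n k"] fat_cantor_level_antimono[of k "max n k"] by auto
  then show "t \<in> fat_cantor" "t + fat_len n \<in> fat_cantor"
    by (auto simp: fat_cantor_def)
qed

lemma bounded_fat_cantor_square: "bounded (fat_cantor \<times> fat_cantor)"
  using compact_fat_cantor by (intro bounded_Times compact_imp_bounded)

lemma zero_in_fat_cantor: "0 \<in> fat_cantor"
  using fat_cantor_cell_ends(1)[of 0 0] by simp

lemma fat_len_in_fat_cantor: "fat_len n \<in> fat_cantor"
  using fat_cantor_cell_ends(2)[of 0 n] by simp

definition cell_corner :: "nat \<Rightarrow> real \<Rightarrow> real" where
  "cell_corner n x = (SOME t. t \<in> left_ends n \<and> x \<in> {t..t + fat_len n})"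

lemma cell_corner:
  assumes "x \<in> fat_cantor"
  shows "cell_corner n x \<in> left_ends n" "cell_corner n x \<le> x" "x \<le> cell_corner n x + fat_len n"
proof -
  have "\<exists>t. t \<in> left_ends n \<and> x \<in> {t..t + fat_len n}"
    using assms unfolding fat_cantor_def fat_cantor_level_eq by blast
  from someI_ex[OF this]
  show "cell_corner n x \<in> left_ends n" "cell_corner n x \<le> x" "x \<le> cell_corner n x + fat_len n"
    by (auto simp: cell_corner_def)
qed

lemma cell_corner_in_fat_cantor: "x \<in> fat_cantor \<Longrightarrow> cell_corner n x \<in> fat_cantor"
  using cell_corner fat_cantor_cell_ends by blast

lemma distinct_cells_dist:
  assumes "x \<in> fat_cantor" "y \<in> fat_cantor" "cell_corner n x \<noteq> cell_corner n y"
  shows "(fat_len n)\<^sup>2 \<le> \<bar>x - y\<bar>"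
  using left_ends_separated[of "cell_corner n x" n "cell_corner n y"]
    left_ends_separated[of "cell_corner n y" n "cell_corner n x"]
    cell_corner[OF assms(1), of n] cell_corner[OF assms(2), of n] assms(3)
  by (cases "cell_corner n x" "cell_corner n y" rule: linorder_cases) auto

section \<open>Bounds for the Hausdorff dimension\<close>

lemma hausdorff_dim_nonneg: "0 \<le> hausdorff_dim A"
  unfolding hausdorff_dim_def by (rule Inf_greatest) auto

lemma hausdorff_dim_leI:
  assumes "0 \<le> s"
    and "\<And>\<delta> \<epsilon>. 0 < \<delta> \<Longrightarrow> 0 < \<epsilon> \<Longrightarrow> hausdorff_premeasure \<delta> s A \<le> ennreal \<epsilon>"
  shows "hausdorff_dim A \<le> ereal s"
proof -
  have "hausdorff_premeasure \<delta> s A \<le> 0" if "0 < \<delta>" for \<delta>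
    by (rule ennreal_le_epsilon) (simp add: assms(2) that)
  then have "hausdorff_measure s A = 0"
    unfolding hausdorff_measure_def by (simp add: SUP_eq_iff)
  then show ?thesis
    unfolding hausdorff_dim_def using assms(1) by (intro Inf_lower) auto
qed

lemma hausdorff_premeasure_finite_cover:
  assumes "0 < s" "0 < \<delta>" "finite \<U>" "A \<subseteq> \<Union>\<U>"
    and \<U>: "\<And>U. U \<in> \<U> \<Longrightarrow> bounded U \<and> diameter U \<le> \<delta>"
  shows "hausdorff_premeasure \<delta> s A \<le> ennreal (real (card \<U>) * \<delta> powr s)"
proof -
  obtain h where h: "bij_betw h {..<card \<U>} \<U>"
    using assms(3) by (metis bij_betw_iff_card card_lessThan finite_lessThan)
  define U where "U i = (if i < card \<U> then h i else {})" for i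
  have "h i \<in> \<U>" if "i < card \<U>" for i
    using h that by (auto simp: bij_betw_def)
  then have U: "bounded (U i) \<and> diameter (U i) \<le> \<delta>" for i
    using \<U> assms(2) by (auto simp: U_def)
  have "A \<subseteq> (\<Union>i<card \<U>. h i)"
    using assms(4) h by (metis bij_betw_def)
  then have "A \<subseteq> (\<Union>i. U i)"
    by (fastforce simp: U_def)
  then have "hausdorff_premeasure \<delta> s A \<le> (\<Sum>i. diam_pow s (U i))"
    unfolding hausdorff_premeasure_def using U by (intro INF_lower) auto
  also have "\<dots> = (\<Sum>i<card \<U>. diam_pow s (U i))"
    by (intro suminf_finite) (auto simp: U_def diam_pow_def)
  also have "\<dots> \<le> (\<Sum>i<card \<U>. ennreal (\<delta> powr s))"
    using U assms(1) by (intro sum_mono) (auto simp: diam_pow_def intro!: ennreal_leI powr_mono2 diameter_ge_0)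
  also have "\<dots> = ennreal (real (card \<U>) * \<delta> powr s)"
    by (simp add: ennreal_mult ennreal_of_nat_eq_real_of_nat)
  finally show ?thesis .
qed

lemma hausdorff_premeasure_mono:
  assumes "0 < s'" "s' \<le> s" "\<delta> \<le> \<delta>'" "\<delta> \<le> 1"
  shows "hausdorff_premeasure \<delta>' s A \<le> hausdorff_premeasure \<delta> s' A"
  unfolding hausdorff_premeasure_def
proof (rule INF_mono)
  fix U assume U: "U \<in> {U :: nat \<Rightarrow> 'a set. A \<subseteq> (\<Union>i. U i) \<and> (\<forall>i. bounded (U i) \<and> diameter (U i) \<le> \<delta>)}"
  have "diam_pow s (U i) \<le> diam_pow s' (U i)" for i
  proof -
    have "0 \<le> diameter (U i)" "diameter (U i) \<le> 1"
      using U assms(4) by (auto intro: diameter_ge_0 order.trans)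
    then have "diameter (U i) powr s \<le> diameter (U i) powr s'"
      using assms(1,2) by (intro powr_mono') auto
    then show ?thesis
      using assms by (auto simp: diam_pow_def intro!: ennreal_leI)
  qed
  then show "\<exists>V\<in>{U. A \<subseteq> (\<Union>i. U i) \<and> (\<forall>i. bounded (U i) \<and> diameter (U i) \<le> \<delta>')}.
      (\<Sum>i. diam_pow s (V i)) \<le> (\<Sum>i. diam_pow s' (U i))"
    using U assms(3) by (intro bexI[of _ U] suminf_le) (auto intro: order.trans)
qed

lemma hausdorff_dim_empty: "hausdorff_dim {} = 0"
proof -
  have "hausdorff_premeasure \<delta> 0 ({}::'a set) \<le> 0" if "0 < \<delta>" for \<delta> :: real
    unfolding hausdorff_premeasure_def
    using that by (intro INF_lower2[of "\<lambda>_. {}"]) (auto simp: diam_pow_def)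
  then have "hausdorff_dim ({}::'a set) \<le> ereal 0"
    by (intro hausdorff_dim_leI) (auto intro: order.trans)
  with hausdorff_dim_nonneg show ?thesis
    by (metis antisym zero_ereal_def)
qed

text \<open>
  A cover of \<open>A\<close> by sets of diameter \<open>d\<^sub>i \<le> 1\<close> yields a cover of the projection by intervals of
  length \<open>2d\<^sub>i\<close>, and \<open>d\<^sub>i \<le> d\<^sub>i\<^sup>s\<close> for \<open>s < 1\<close>. So the \<open>s\<close>-dimensional sums cannot be small when
  the projection has positive length.
\<close>

lemma hausdorff_dim_ge_1_if_projection:
  fixes p :: "'a::metric_space \<Rightarrow> real"
  assumes p: "\<And>x y. dist (p x) (p y) \<le> dist x y"
    and B: "B \<subseteq> p ` A" "B \<in> sets lborel" "0 < emeasure lborel B"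
  shows "1 \<le> hausdorff_dim A"
  unfolding hausdorff_dim_def
proof (rule Inf_greatest, clarify)
  fix s :: real
  assume s: "0 \<le> s" "hausdorff_measure s A = 0"
  show "1 \<le> ereal s"
  proof (rule ccontr)
    assume "\<not> 1 \<le> ereal s"
    then have s1: "s < 1" by simp
    have "hausdorff_premeasure 1 s A \<le> hausdorff_measure s A"
      unfolding hausdorff_measure_def by (rule SUP_upper) auto
    then have pre: "hausdorff_premeasure 1 s A = 0"
      using s by simp
    have small: "emeasure lborel B \<le> 0 + ennreal \<epsilon>" if "0 < \<epsilon>" for \<epsilon>
    proof -
      have "hausdorff_premeasure 1 s A < ennreal (\<epsilon> / 2)"
        using pre that by simp
      then obtain U where U: "A \<subseteq> (\<Union>i. U i)" "\<And>i. bounded (U i)" "\<And>i. diameter (U i) \<le> 1"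
          and sum: "(\<Sum>i. diam_pow s (U i)) < ennreal (\<epsilon> / 2)"
        unfolding hausdorff_premeasure_def INF_less_iff by blast
      define V where "V i = (if U i = {} then {} else
          cball (p (SOME u. u \<in> U i)) (diameter (U i)))" for i
      have "p u \<in> V i" if "u \<in> U i" for u i
      proof -
        have "(SOME u. u \<in> U i) \<in> U i"
          using that by (rule someI)
        then have "dist (SOME u. u \<in> U i) u \<le> diameter (U i)"
          using diameter_bounded_bound[OF U(2)] that by blast
        then show ?thesis
          using p[of "SOME u. u \<in> U i" u] that by (auto simp: V_def)
      qed
      then have "p ` A \<subseteq> (\<Union>i. V i)"
        using U(1) unfolding image_subset_iff by (meson UN_iff UNIV_I subsetD)
      with B(1) have "B \<subseteq> (\<Union>i. V i)"
        by (rule order.trans)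
      then have "emeasure lborel B \<le> emeasure lborel (\<Union>i. V i)"
        by (intro emeasure_mono) (auto simp: V_def)
      also have "\<dots> \<le> (\<Sum>i. emeasure lborel (V i))"
        by (intro emeasure_subadditive_countably) (auto simp: V_def)
      also have "\<dots> \<le> (\<Sum>i. 2 * diam_pow s (U i))"
      proof (intro suminf_le)
        fix i
        have d: "0 \<le> diameter (U i)" using U(2) by (rule diameter_ge_0)
        have "diameter (U i) \<le> diameter (U i) powr s" if "s \<noteq> 0"
          using powr_mono'[of s 1 "diameter (U i)"] s1 d U(3)[of i] by simp
        then have "ennreal (diameter (U i)) \<le> diam_pow s (U i)" if "U i \<noteq> {}"
          using that U(3)[of i] ennreal_leI[of "diameter (U i)" 1]
          by (auto simp: diam_pow_def intro: ennreal_leI)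
        moreover have "emeasure lborel (V i) = 2 * ennreal (diameter (U i))"
          using d ennreal_mult[of 2 "diameter (U i)"] by (simp add: V_def cball_eq_atLeastAtMost)
        ultimately show "emeasure lborel (V i) \<le> 2 * diam_pow s (U i)"
          by (cases "U i = {}") (auto simp: V_def intro!: mult_left_mono)
      qed auto
      also have "\<dots> = 2 * (\<Sum>i. diam_pow s (U i))"
        by simp
      also have "\<dots> \<le> 2 * ennreal (\<epsilon> / 2)"
        using sum by (intro mult_left_mono) auto
      also have "\<dots> = ennreal \<epsilon>"
        using ennreal_mult[of 2 "\<epsilon> / 2"] that by simp
      finally show ?thesis by simp
    qed
    have "emeasure lborel B \<le> 0"
      by (rule ennreal_le_epsilon) (rule small)
    with B(3) show False by simp
  qed
qed

lemma D_lower_fun_nonneg: "0 \<le> D_lower_fun f F"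
proof -
  have "{r. ereal 0 \<le> level_dim f r F} = UNIV"
    using hausdorff_dim_nonneg by (auto simp: level_dim_def zero_ereal_def[symmetric])
  then have "0 < outer_measure_of lebesgue {r. ereal 0 \<le> level_dim f r F}"
    by simp
  then show ?thesis
    unfolding D_lower_fun_def by (intro Sup_upper) (auto simp: zero_ereal_def)
qed

lemma D_lower_fun_leI:
  assumes "N \<in> null_sets lborel" "\<And>r. r \<notin> N \<Longrightarrow> level_dim f r F \<le> ereal c"
  shows "D_lower_fun f F \<le> ereal c"
  unfolding D_lower_fun_def
proof (rule Sup_least, clarify)
  fix d assume d: "0 < outer_measure_of lebesgue {r. ereal d \<le> level_dim f r F}"
  show "ereal d \<le> ereal c"
  proof (rule ccontr)
    assume "\<not> ereal d \<le> ereal c"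
    then have "{r. ereal d \<le> level_dim f r F} \<subseteq> N"
      using assms(2) order.trans by blast
    then have "outer_measure_of lebesgue {r. ereal d \<le> level_dim f r F} \<le> outer_measure_of lebesgue N"
      by (rule outer_measure_of_mono)
    also have "\<dots> = 0"
      using null_sets_completionI[OF assms(1)] by (auto simp: null_sets_def)
    finally show False using d by simp
  qed
qed

lemma D_lower_fun_geI:
  assumes "0 \<le> d" "R \<in> sets lborel" "0 < emeasure lborel R"
    and "\<And>r. r \<in> R \<Longrightarrow> ereal d \<le> level_dim f r F"
  shows "ereal d \<le> D_lower_fun f F"
proof -
  have "0 < emeasure lebesgue R"
    using assms(2,3) by simp
  also have "\<dots> = outer_measure_of lebesgue R"
    using assms(2) by (intro outer_measure_of_eq[symmetric] sets_completionI_sets) auto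
  also have "\<dots> \<le> outer_measure_of lebesgue {r. ereal d \<le> level_dim f r F}"
    using assms(4) by (intro outer_measure_of_mono) auto
  finally show ?thesis
    unfolding D_lower_fun_def using assms(1) by (intro Sup_upper) auto
qed

section \<open>Generic Hoelder functions\<close>

lemma holder_onD: "holder_on c \<alpha> F f \<Longrightarrow> x \<in> F \<Longrightarrow> y \<in> F \<Longrightarrow> \<bar>f x - f y\<bar> \<le> c * dist x y powr \<alpha>"
  by (auto simp: holder_on_def)

lemma holder_on_imp_continuous_on:
  assumes "holder_on c \<alpha> F f" "0 < \<alpha>"
  shows "continuous_on F f"
  unfolding continuous_on_def
proof
  fix x assume x: "x \<in> F"
  have "((\<lambda>y. c * dist y x powr \<alpha>) \<longlongrightarrow> c * dist x x powr \<alpha>) (at x within F)"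
    using assms(2) by (intro tendsto_intros) auto
  then have "((\<lambda>y. c * dist y x powr \<alpha>) \<longlongrightarrow> 0) (at x within F)"
    by simp
  moreover have "\<forall>\<^sub>F y in at x within F. norm (dist (f y) (f x)) \<le> c * dist y x powr \<alpha>"
    using assms(1) x by (auto simp: eventually_at_filter holder_on_def dist_real_def)
  ultimately have "((\<lambda>y. dist (f y) (f x)) \<longlongrightarrow> 0) (at x within F)"
    by (rule Lim_null_comparison[rotated])
  then show "(f \<longlongrightarrow> f x) (at x within F)"
    by (rule tendsto_dist_iff[THEN iffD2])
qed

lemma mspace_holder1_space:
  "mspace (holder1_space \<alpha> F) = {f. holder_on 1 \<alpha> F f \<and> f \<in> extensional F \<and> bounded (f ` F)}"
  by (auto simp: holder1_space_def Met_TC.fspace_def)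

lemma restrict_in_holder1_space:
  assumes "holder_on 1 \<alpha> F f" "bounded F" "0 < \<alpha>"
  shows "restrict f F \<in> mspace (holder1_space \<alpha> F)"
proof -
  have "dist (f x) (f y) \<le> diameter F powr \<alpha>" if "x \<in> F" "y \<in> F" for x y
  proof -
    have "dist (f x) (f y) \<le> dist x y powr \<alpha>"
      using holder_onD[OF assms(1) that] by (simp add: dist_real_def)
    also have "\<dots> \<le> diameter F powr \<alpha>"
      using assms that by (intro powr_mono2 diameter_bounded_bound) auto
    finally show ?thesis .
  qed
  then have "bounded (f ` F)"
    unfolding bounded_def by (cases "F = {}") (blast, fast)
  then show ?thesis
    using assms(1) by (simp add: mspace_holder1_space holder_on_def)
qed

lemma holder_bounded:
  assumes "holder_on 1 \<alpha> F f" "bounded F" "0 < \<alpha>"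
  obtains B where "0 < B" "\<And>x. x \<in> F \<Longrightarrow> \<bar>f x\<bar> \<le> B"
proof -
  have "bounded (restrict f F ` F)"
    using restrict_in_holder1_space[OF assms] unfolding mspace_holder1_space by blast
  then obtain B where "0 < B" "\<And>x. x \<in> restrict f F ` F \<Longrightarrow> norm x \<le> B"
    unfolding bounded_pos by blast
  with that show thesis by (simp add: image_iff) (metis restrict_apply')
qed

lemma mdist_holder1_space_le:
  assumes "f \<in> mspace (holder1_space \<alpha> F)" "g \<in> mspace (holder1_space \<alpha> F)" "F \<noteq> {}"
  shows "mdist (holder1_space \<alpha> F) f g \<le> \<epsilon> \<longleftrightarrow> (\<forall>x\<in>F. \<bar>f x - g x\<bar> \<le> \<epsilon>)"
  using assms funspace_mdist_le[of f F euclidean_metric g \<epsilon>]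
  by (simp add: holder1_space_def dist_real_def)

text \<open>The Hoelder condition survives pointwise limits, so it defines a closed set of functions.\<close>

lemma mcomplete_holder1_space:
  assumes "F \<noteq> {}"
  shows "mcomplete_of (holder1_space \<alpha> F)"
proof -
  let ?E = "funspace F (euclidean_metric :: real metric)"
  let ?H = "mspace (holder1_space \<alpha> F)"
  have H: "?H = {f. holder_on 1 \<alpha> F f} \<inter> mspace ?E" "mdist (holder1_space \<alpha> F) = mdist ?E"
    by (simp_all add: holder1_space_def)
  interpret Submetric "mspace ?E" "mdist ?E" ?H
    by (simp add: Submetric_def Submetric_axioms_def H(1) del: mspace_funspace mdist_funspace)
  have "mcomplete"
    using Met_TC.mcomplete_funspace[where 'a = real, of F] mcomplete_iff_complete complete_UNIV
    by (simp add: mcomplete_of_def euclidean_metric_def Met_TC.Self_def)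
  then have "sub.mcomplete"
  proof (rule sequentially_closedin_mcomplete_imp_mcomplete)
    fix \<sigma> l
    assume *: "range \<sigma> \<subseteq> ?H \<and> limitin mtopology \<sigma> l sequentially"
    then have l: "l \<in> mspace ?E" and \<sigma>: "\<And>n. \<sigma> n \<in> mspace ?E" "\<And>n. holder_on 1 \<alpha> F (\<sigma> n)"
      and lim: "\<And>\<epsilon>. \<epsilon> > 0 \<Longrightarrow> \<forall>\<^sub>F n in sequentially. mdist ?E (\<sigma> n) l < \<epsilon>"
      unfolding limit_metric_sequentially H eventually_sequentially by blast+
    have pt: "(\<lambda>n. \<sigma> n x) \<longlonglongrightarrow> l x" if "x \<in> F" for x
    proof (rule tendstoI)
      fix \<epsilon> :: real assume "\<epsilon> > 0"
      from lim[OF this] show "\<forall>\<^sub>F n in sequentially. dist (\<sigma> n x) (l x) < \<epsilon>"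
      proof eventually_elim
        case (elim n)
        have "dist (\<sigma> n x) (l x) \<le> mdist ?E (\<sigma> n) l"
          using Urysohn.funspace_mdist_le[OF \<sigma>(1) l assms, of n "mdist ?E (\<sigma> n) l"] that by simp
        with elim show ?case by simp
      qed
    qed
    have "holder_on 1 \<alpha> F l"
      unfolding holder_on_def
    proof (intro ballI)
      fix x y assume "x \<in> F" "y \<in> F"
      then show "\<bar>l x - l y\<bar> \<le> 1 * dist x y powr \<alpha>"
        using \<sigma>(2) by (intro tendsto_upperbound[OF tendsto_rabs[OF tendsto_diff[OF pt pt]]])
          (auto simp: holder_on_def)
    qed
    with l show "l \<in> ?H" by (simp add: H)
  qed
  then show ?thesis
    by (simp add: mcomplete_of_def H(2))
qed

text \<open>
  By Baire's theorem, a sequence of properties holds simultaneously for some member of any dense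
  \<open>G\<^sub>\<delta>\<close> set as soon as each of them holds throughout a neighbourhood of every function from a
  dense set. All upper bounds on \<open>D\<^sub>*\<close> come from such stable properties of simple functions.
\<close>

lemma generic_holder_property:
  fixes F :: "'a::metric_space set"
  assumes F: "F \<noteq> {}" "bounded F" "0 < \<alpha>" and G: "G \<in> dense_gdeltas \<alpha> F"
    and dense: "\<And>n::nat. \<And>f \<epsilon>. holder_on 1 \<alpha> F f \<Longrightarrow> 0 < \<epsilon> \<Longrightarrow>
      \<exists>g \<delta>. holder_on 1 \<alpha> F g \<and> (\<forall>x\<in>F. \<bar>f x - g x\<bar> \<le> \<epsilon>) \<and> 0 < \<delta> \<and>
        (\<forall>h. holder_on 1 \<alpha> F h \<and> (\<forall>x\<in>F. \<bar>h x - g x\<bar> \<le> \<delta>) \<longrightarrow> P n h)"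
  shows "\<exists>f\<in>G. holder_on 1 \<alpha> F f \<and> (\<forall>n. P n f)"
proof -
  let ?X = "holder1_space \<alpha> F"
  interpret Metric_space "mspace ?X" "mdist ?X"
    by simp
  have T: "mtopology_of ?X = mtopology"
    by (simp add: mtopology_of_def)
  define B where "B n = {(g, \<delta>). g \<in> mspace ?X \<and> 0 < \<delta> \<and> (\<forall>h \<in> mball g \<delta>. P n h)}" for n
  define U where "U n = (\<Union>(g, \<delta>) \<in> B n. mball g \<delta>)" for n
  have "openin mtopology (U n)" for n
    unfolding U_def by (intro openin_Union) auto
  moreover have "mtopology closure_of (U n) = mspace ?X" for n
  proof
    show "mspace ?X \<subseteq> mtopology closure_of (U n)"
    proof
      fix f assume f: "f \<in> mspace ?X"
      have "\<exists>g\<in>U n. g \<in> mball f \<epsilon>" if "\<epsilon> > 0" for \<epsilon>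
      proof -
        have "holder_on 1 \<alpha> F f" using f by (simp add: mspace_holder1_space)
        from dense[OF this, of "\<epsilon> / 2" n] that
        obtain g \<delta> where g: "holder_on 1 \<alpha> F g" "\<And>x. x \<in> F \<Longrightarrow> \<bar>f x - g x\<bar> \<le> \<epsilon> / 2" "0 < \<delta>"
          "\<And>h. holder_on 1 \<alpha> F h \<Longrightarrow> (\<forall>x\<in>F. \<bar>h x - g x\<bar> \<le> \<delta>) \<Longrightarrow> P n h"
          by auto
        let ?g = "restrict g F"
        have gX: "?g \<in> mspace ?X"
          using restrict_in_holder1_space g(1) F by blast
        have "P n h" if "h \<in> mball ?g \<delta>" for h
        proof (rule g(4))
          show "holder_on 1 \<alpha> F h"
            using in_mball[THEN iffD1, OF that] unfolding mspace_holder1_space by blast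
          have "mdist ?X h ?g \<le> \<delta>"
            using that commute[of h ?g] by simp
          then show "\<forall>x\<in>F. \<bar>h x - g x\<bar> \<le> \<delta>"
            using mdist_holder1_space_le[of h \<alpha> F ?g \<delta>] that gX F(1) by simp
        qed
        then have "(?g, \<delta>) \<in> B n" using gX g(3) by (simp add: B_def)
        then have "?g \<in> U n"
          unfolding U_def using gX g(3) by force
        moreover have "mdist ?X f ?g \<le> \<epsilon> / 2"
          using mdist_holder1_space_le[of f \<alpha> F ?g "\<epsilon> / 2"] f gX F(1) g(2) by simp
        ultimately show ?thesis
          using f gX that by (intro bexI[of _ ?g]) auto
      qed
      then show "f \<in> mtopology closure_of (U n)"
        using f unfolding metric_closure_of by blast
    qed
  qed (use closure_of_subset_topspace in fastforce)
  ultimately have U: "openin mtopology (U n) \<and> mtopology closure_of (U n) = mspace ?X" for n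
    by blast
  obtain \<V> where \<V>: "countable \<V>" "\<And>V. V \<in> \<V> \<Longrightarrow> openin mtopology V" "\<Inter>\<V> = G"
      and G_dense: "mtopology closure_of G = mspace ?X"
    using G unfolding dense_gdeltas_def T Let_def gdelta_in_alt intersection_of_def by auto
  have V: "openin mtopology V \<and> mtopology closure_of V = mspace ?X" if "V \<in> \<V>" for V
    using \<V>(2)[OF that] closure_of_mono[of G V mtopology] \<V>(3) that G_dense
      closure_of_subset_topspace[of mtopology V] by (auto simp: topspace_mtopology)
  have "mcomplete"
    using mcomplete_holder1_space F(1) by (simp add: mcomplete_of_def)
  then have "mtopology closure_of \<Inter>(range U \<union> \<V>) = mspace ?X"
    using U V \<V>(1) by (intro metric_Baire_category) auto
  moreover have "mspace ?X \<noteq> {}"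
    using restrict_in_holder1_space[of \<alpha> F "\<lambda>_. 0"] F by (auto simp: holder_on_def)
  ultimately obtain f where f: "f \<in> \<Inter>(range U \<union> \<V>)"
    by (metis closure_of_empty ex_in_conv)
  then have "f \<in> G" "\<And>n. f \<in> U n"
    using \<V>(3) by auto
  moreover have "P n f" for n
    using \<open>f \<in> U n\<close> by (auto simp: U_def B_def)
  moreover have "f \<in> mspace ?X"
    using \<open>f \<in> U 0\<close> by (auto simp: U_def)
  then have "holder_on 1 \<alpha> F f"
    unfolding mspace_holder1_space by blast
  ultimately show ?thesis by blast
qed

text \<open>
  The space consists of functions that are undefined outside \<open>F\<close>, while approximations are most
  easily given as total functions; hence \<open>P\<close> has to depend on the values on \<open>F\<close> only.
\<close>

lemma dense_open_in_dense_gdeltas: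
  fixes F :: "'a::metric_space set"
  assumes F: "F \<noteq> {}" "bounded F" "0 < \<alpha>"
    and cong: "\<And>f g. (\<And>x. x \<in> F \<Longrightarrow> f x = g x) \<Longrightarrow> P f \<Longrightarrow> P g"
    and op: "\<And>f. holder_on 1 \<alpha> F f \<Longrightarrow> P f \<Longrightarrow>
      \<exists>\<delta>>0. \<forall>h. (\<forall>x\<in>F. \<bar>h x - f x\<bar> < \<delta>) \<longrightarrow> P h"
    and dense: "\<And>f \<epsilon>. holder_on 1 \<alpha> F f \<Longrightarrow> 0 < \<epsilon> \<Longrightarrow>
      \<exists>g. holder_on 1 \<alpha> F g \<and> (\<forall>x\<in>F. \<bar>f x - g x\<bar> \<le> \<epsilon>) \<and> P g"
  shows "{f \<in> mspace (holder1_space \<alpha> F). P f} \<in> dense_gdeltas \<alpha> F"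
proof -
  let ?X = "holder1_space \<alpha> F"
  let ?O = "{f \<in> mspace ?X. P f}"
  interpret Metric_space "mspace ?X" "mdist ?X"
    by simp
  have T: "mtopology_of ?X = mtopology"
    by (simp add: mtopology_of_def)
  have "openin mtopology ?O"
    unfolding openin_mtopology
  proof (intro conjI allI impI)
    fix f assume f: "f \<in> ?O"
    with op[of f] obtain \<delta> where \<delta>: "\<delta> > 0" "\<And>h. (\<forall>x\<in>F. \<bar>h x - f x\<bar> < \<delta>) \<Longrightarrow> P h"
      by (auto simp: mspace_holder1_space)
    have "mball f \<delta> \<subseteq> ?O"
    proof
      fix h assume h: "h \<in> mball f \<delta>"
      then have "\<forall>x\<in>F. \<bar>h x - f x\<bar> \<le> mdist ?X f h"
        using mdist_holder1_space_le[of h \<alpha> F f "mdist ?X f h"] f F(1) commute[of h f] by auto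
      then have "P h"
        using h by (intro \<delta>(2)) (auto intro: le_less_trans)
      with h show "h \<in> ?O" by simp
    qed
    with \<delta>(1) show "\<exists>r>0. mball f r \<subseteq> ?O" by blast
  qed auto
  moreover have "mspace ?X \<subseteq> mtopology closure_of ?O"
  proof
    fix f assume f: "f \<in> mspace ?X"
    have "\<exists>g\<in>?O. g \<in> mball f \<epsilon>" if "\<epsilon> > 0" for \<epsilon>
    proof -
      have "holder_on 1 \<alpha> F f" using f by (simp add: mspace_holder1_space)
      from dense[OF this, of "\<epsilon> / 2"] that
      obtain g where g: "holder_on 1 \<alpha> F g" "\<And>x. x \<in> F \<Longrightarrow> \<bar>f x - g x\<bar> \<le> \<epsilon> / 2" "P g"
        by auto
      let ?g = "restrict g F"
      have gX: "?g \<in> mspace ?X"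
        using restrict_in_holder1_space g(1) F by blast
      moreover have "P ?g"
        using g(3) by (rule cong[rotated]) simp
      moreover have "mdist ?X f ?g \<le> \<epsilon> / 2"
        using mdist_holder1_space_le[of f \<alpha> F ?g "\<epsilon> / 2"] f gX F(1) g(2) by simp
      ultimately show ?thesis
        using f that by (intro bexI[of _ ?g]) auto
    qed
    then show "f \<in> mtopology closure_of ?O"
      using f unfolding metric_closure_of by blast
  qed
  ultimately show ?thesis
    unfolding dense_gdeltas_def T Let_def
    using closure_of_subset_topspace[of mtopology ?O]
    by (auto simp: open_imp_gdelta_in)
qed

section \<open>Lipschitz functions are dense\<close>

text \<open>
  \<open>min (t\<^sup>\<alpha>) (K t)\<close> for \<open>t > 0\<close>. Writing it as \<open>t\<close> times a decreasing function makes it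
  subadditive.
\<close>

definition truncated_modulus :: "real \<Rightarrow> real \<Rightarrow> real \<Rightarrow> real" where
  "truncated_modulus \<alpha> K t = t * min (t powr (\<alpha> - 1)) K"

lemma truncated_modulus_le:
  assumes "0 \<le> t"
  shows "truncated_modulus \<alpha> K t \<le> t powr \<alpha>" "truncated_modulus \<alpha> K t \<le> K * t"
proof -
  have "t * t powr (\<alpha> - 1) = t powr \<alpha>"
    using assms by (cases "t = 0") (auto simp: powr_diff)
  then show "truncated_modulus \<alpha> K t \<le> t powr \<alpha>"
    unfolding truncated_modulus_def using assms by (metis min.cobounded1 mult_left_mono)
  show "truncated_modulus \<alpha> K t \<le> K * t"
    unfolding truncated_modulus_def using assms
    by (metis min.cobounded2 mult_left_mono mult.commute)
qed

lemma truncated_modulus_mono: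
  assumes "0 < \<alpha>" "0 \<le> K" "0 \<le> s" "s \<le> t"
  shows "truncated_modulus \<alpha> K s \<le> truncated_modulus \<alpha> K t"
proof -
  have eq: "truncated_modulus \<alpha> K u = min (u powr \<alpha>) (K * u)" if "0 \<le> u" for u
    using that by (cases "u = 0")
      (auto simp: truncated_modulus_def min_mult_distrib_left powr_diff mult.commute)
  have "s powr \<alpha> \<le> t powr \<alpha>" "K * s \<le> K * t"
    using assms by (auto intro: powr_mono2 mult_left_mono)
  then show ?thesis
    using assms by (simp add: eq min.coboundedI1 min.coboundedI2)
qed

lemma truncated_modulus_subadditive:
  assumes "\<alpha> \<le> 1" "0 \<le> s" "0 \<le> t"
  shows "truncated_modulus \<alpha> K (s + t) \<le> truncated_modulus \<alpha> K s + truncated_modulus \<alpha> K t"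
proof -
  have dec: "v * min ((s + t) powr (\<alpha> - 1)) K \<le> v * min (v powr (\<alpha> - 1)) K"
    if "0 \<le> v" "v \<le> s + t" for v
  proof (cases "v = 0")
    case False
    then have "(s + t) powr (\<alpha> - 1) \<le> v powr (\<alpha> - 1)"
      using that assms(1) by (intro powr_mono2') auto
    then show ?thesis
      using that(1) by (intro mult_left_mono) auto
  qed simp
  show ?thesis
    using dec[of s] dec[of t] assms by (simp add: truncated_modulus_def distrib_right)
qed

lemma truncated_modulus_approximates:
  assumes "0 < \<alpha>" "\<alpha> \<le> 1" "0 < \<epsilon>"
  shows "\<exists>K>0. \<forall>t\<ge>0. t powr \<alpha> - \<epsilon> \<le> truncated_modulus \<alpha> K t"
proof -
  define \<tau> where "\<tau> = \<epsilon> powr (1 / \<alpha>)"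
  have \<tau>: "\<tau> > 0" "\<tau> powr \<alpha> = \<epsilon>"
    using assms by (auto simp: \<tau>_def powr_powr)
  define K where "K = \<tau> powr (\<alpha> - 1)"
  have "t powr \<alpha> - \<epsilon> \<le> truncated_modulus \<alpha> K t" if "t \<ge> 0" for t
  proof (cases "t \<le> \<tau>")
    case True
    then have "t powr \<alpha> \<le> \<epsilon>"
      using powr_mono2[of \<alpha> t \<tau>] \<tau> that assms by simp
    moreover have "0 \<le> truncated_modulus \<alpha> K t"
      using that by (auto simp: truncated_modulus_def K_def)
    ultimately show ?thesis by linarith
  next
    case False
    then have "t powr (\<alpha> - 1) \<le> K"
      unfolding K_def using assms \<tau> by (intro powr_mono2') auto
    then have "truncated_modulus \<alpha> K t = t * t powr (\<alpha> - 1)"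
      by (simp add: truncated_modulus_def)
    also have "\<dots> = t powr \<alpha>"
      using False \<tau> by (simp add: powr_diff)
    finally show ?thesis using assms by simp
  qed
  moreover have "K > 0" using \<tau> by (simp add: K_def)
  ultimately show ?thesis by blast
qed

text \<open>
  The infimal convolution of \<open>f\<close> with the metric \<open>\<omega>(|x - y|)\<close>, where \<open>\<omega>(t) = min (t\<^sup>\<alpha>) (K t)\<close>, is
  1-Lipschitz for that metric, which makes it both 1-Hoelder-\<open>\<alpha>\<close> and \<open>K\<close>-Lipschitz. For large
  \<open>K\<close> one has \<open>\<omega>(t) \<ge> t\<^sup>\<alpha> - \<epsilon>\<close>, so that it stays within \<open>\<epsilon>\<close> of \<open>f\<close>.
\<close>

lemma holder_lipschitz_approximation:
  fixes f :: "'a::metric_space \<Rightarrow> real"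
  assumes \<alpha>: "0 < \<alpha>" "\<alpha> \<le> 1" and f: "holder_on 1 \<alpha> F f" and "0 < \<epsilon>"
  obtains g K where "0 < K" "holder_on 1 \<alpha> F g" "\<And>x y. x \<in> F \<Longrightarrow> y \<in> F \<Longrightarrow> \<bar>g x - g y\<bar> \<le> K * dist x y"
    "\<And>x. x \<in> F \<Longrightarrow> \<bar>f x - g x\<bar> \<le> \<epsilon>"
proof -
  obtain K where K: "K > 0" "\<And>t. t \<ge> 0 \<Longrightarrow> t powr \<alpha> - \<epsilon> \<le> truncated_modulus \<alpha> K t"
    using truncated_modulus_approximates[OF \<alpha> \<open>0 < \<epsilon>\<close>] by blast
  let ?\<omega> = "truncated_modulus \<alpha> K"
  define g where "g x = (INF y\<in>F. f y + ?\<omega> (dist x y))" for x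
  have lower: "f x - \<epsilon> \<le> f y + ?\<omega> (dist x y)" if "x \<in> F" "y \<in> F" for x y
    using K(2)[of "dist x y"] holder_onD[OF f that] by simp
  then have bdd: "bdd_below ((\<lambda>y. f y + ?\<omega> (dist x y)) ` F)" if "x \<in> F" for x
    using that by (intro bdd_belowI2) auto
  have half: "g x \<le> g y + ?\<omega> (dist x y)" if "x \<in> F" "y \<in> F" for x y
  proof -
    have "g x - ?\<omega> (dist x y) \<le> f z + ?\<omega> (dist y z)" if "z \<in> F" for z
    proof -
      have "g x \<le> f z + ?\<omega> (dist x z)"
        unfolding g_def using bdd \<open>x \<in> F\<close> \<open>z \<in> F\<close> by (intro cINF_lower) auto
      also have "?\<omega> (dist x z) \<le> ?\<omega> (dist x y + dist y z)"
        using \<alpha> K(1) by (intro truncated_modulus_mono dist_triangle) auto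
      also have "\<dots> \<le> ?\<omega> (dist x y) + ?\<omega> (dist y z)"
        using \<alpha> by (intro truncated_modulus_subadditive) auto
      finally show ?thesis by linarith
    qed
    then have "g x - ?\<omega> (dist x y) \<le> g y"
      unfolding g_def[of y] using \<open>y \<in> F\<close> by (intro cINF_greatest) auto
    then show ?thesis by linarith
  qed
  have g: "\<bar>g x - g y\<bar> \<le> ?\<omega> (dist x y)" if "x \<in> F" "y \<in> F" for x y
    using half[OF that] half[OF that(2,1)] by (simp add: dist_commute)
  show thesis
  proof (rule that[OF K(1)])
    show "holder_on 1 \<alpha> F g"
      unfolding holder_on_def using order.trans[OF g truncated_modulus_le(1)[OF zero_le_dist]] by simp
    show "\<bar>g x - g y\<bar> \<le> K * dist x y" if "x \<in> F" "y \<in> F" for x y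
      using g[OF that] truncated_modulus_le(2)[OF zero_le_dist] by (rule order.trans)
    show "\<bar>f x - g x\<bar> \<le> \<epsilon>" if "x \<in> F" for x
    proof -
      have "g x \<le> f x + ?\<omega> (dist x x)"
        unfolding g_def using bdd that by (intro cINF_lower) auto
      moreover have "f x - \<epsilon> \<le> g x"
        unfolding g_def using lower that by (intro cINF_greatest) auto
      ultimately show ?thesis
        using \<open>0 < \<epsilon>\<close> by (simp add: truncated_modulus_def)
    qed
  qed
qed

section \<open>Generic level sets in the plane have dimension at most one\<close>

lemma sum_indicator_eq_card:
  "finite I \<Longrightarrow> (\<Sum>i\<in>I. indicator (J i) r :: ennreal) = of_nat (card {i \<in> I. r \<in> J i})"
  by (simp add: indicator_def sum.If_cases Int_def of_nat_eq_enat flip: sum.inter_filter)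

lemma dist_pair_le: "dist p q \<le> \<bar>fst p - fst q\<bar> + \<bar>snd p - snd q\<bar>" for p q :: "real \<times> real"
  by (simp add: dist_prod_def dist_real_def sqrt_sum_squares_le_sum_abs)

definition grid_square :: "nat \<Rightarrow> nat \<times> nat \<Rightarrow> (real \<times> real) set" where
  "grid_square N = (\<lambda>(i, j). {real i / real N..(real i + 1) / real N} \<times> {real j / real N..(real j + 1) / real N})"

lemma grid_square_dist:
  assumes "N > 0" "p \<in> grid_square N q" "p' \<in> grid_square N q"
  shows "dist p p' \<le> 2 / real N"
proof -
  obtain i j where q: "q = (i, j)" by (cases q)
  have *: "\<bar>u - v\<bar> \<le> 1 / real N" if "u \<in> {real k / real N..(real k + 1) / real N}"
      "v \<in> {real k / real N..(real k + 1) / real N}" for u v k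
    using that by (auto simp: add_divide_distrib)
  have "dist p p' \<le> \<bar>fst p - fst p'\<bar> + \<bar>snd p - snd p'\<bar>"
    by (rule dist_pair_le)
  also have "\<dots> \<le> 1 / real N + 1 / real N"
    using assms(2,3) unfolding q grid_square_def by (intro add_mono *[of _ i] *[of _ j]) auto
  finally show ?thesis by simp
qed

lemma grid_square_cover:
  assumes "N > 0" "p \<in> {0..1} \<times> {0..1}"
  shows "\<exists>q \<in> {..<N} \<times> {..<N}. p \<in> grid_square N q"
proof -
  have *: "\<exists>i<N. u \<in> {real i / real N..(real i + 1) / real N}" if "u \<in> {0..1}" for u :: real
  proof (cases "u = 1")
    case True
    then show ?thesis
      using assms(1) by (intro exI[of _ "N - 1"]) (auto simp: of_nat_diff)
  next
    case False
    let ?i = "nat \<lfloor>u * N\<rfloor>"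
    have i: "real ?i \<le> u * N" "u * N < real ?i + 1"
      using that by (auto simp: of_nat_nat)
    have "real ?i < real N"
      using i(1) that False assms(1) by (smt (verit) atLeastAtMost_iff mult_less_cancel_right2 of_nat_0_less_iff)
    then have "?i < N" by simp
    with i show ?thesis
      using assms(1) by (intro exI[of _ ?i]) (auto simp: field_simps)
  qed
  obtain u v where p: "p = (u, v)" "u \<in> {0..1}" "v \<in> {0..1}"
    using assms(2) by auto
  obtain i j where "i < N" "u \<in> {real i / real N..(real i + 1) / real N}"
      "j < N" "v \<in> {real j / real N..(real j + 1) / real N}"
    using *[OF p(2)] *[OF p(3)] by blast
  then show ?thesis
    by (intro bexI[of _ "(i, j)"]) (auto simp: grid_square_def p(1))
qed

text \<open>
  Let \<open>g\<close> be \<open>K\<close>-Lipschitz and cut the unit square into \<open>N\<^sup>2\<close> squares. On each of them, a function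
  within \<open>1/N\<close> of \<open>g\<close> takes its values in an interval of length \<open>6K/N\<close> that depends on \<open>g\<close>
  alone. The number of squares whose interval contains a given level has integral \<open>6KN\<close> over all
  levels, so by Markov's inequality it is below \<open>2\<^sup>n 6KN\<close> outside a set of levels of measure at
  most \<open>2\<^sup>-\<^sup>n\<close>. For the remaining levels, \<open>O(N)\<close> squares of diameter at most \<open>2/N\<close> cover the level
  set, and their \<open>s\<close>-dimensional sums tend to \<open>0\<close> with growing \<open>N\<close> when \<open>s > 1\<close>.
\<close>

lemma lipschitz_level_sets_cover:
  fixes g :: "real \<times> real \<Rightarrow> real"
  assumes F: "F \<subseteq> {0..1} \<times> {0..1}" and K: "1 \<le> K"
    and g: "\<And>x y. x \<in> F \<Longrightarrow> y \<in> F \<Longrightarrow> \<bar>g x - g y\<bar> \<le> K * dist x y"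
    and "0 < \<epsilon>" "\<epsilon> \<le> 1"
  obtains \<delta> B where "0 < \<delta>" "B \<in> sets lborel" "emeasure lborel B \<le> ennreal ((1/2) ^ n)"
    "\<And>h r. (\<And>x. x \<in> F \<Longrightarrow> \<bar>h x - g x\<bar> \<le> \<delta>) \<Longrightarrow> r \<notin> B \<Longrightarrow>
       hausdorff_premeasure \<epsilon> (1 + \<epsilon>) {x \<in> F. h x = r} \<le> ennreal \<epsilon>"
proof -
  have "(\<lambda>N. 6 * K * 2 ^ n * real N * (2 / real N) powr (1 + \<epsilon>)) \<longlonglongrightarrow> 0"
    using \<open>0 < \<epsilon>\<close> K by real_asymp
  then have "\<forall>\<^sub>F N in sequentially. 6 * K * 2 ^ n * real N * (2 / real N) powr (1 + \<epsilon>) < \<epsilon>"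
    using \<open>0 < \<epsilon>\<close> by (rule order_tendstoD)
  moreover have "(\<lambda>N. 2 / real N) \<longlonglongrightarrow> 0"
    by real_asymp
  then have "\<forall>\<^sub>F N in sequentially. 2 / real N < \<epsilon>"
    using \<open>0 < \<epsilon>\<close> by (rule order_tendstoD)
  moreover have "\<forall>\<^sub>F N in sequentially. N > (0::nat)"
    by (rule eventually_gt_at_top)
  ultimately have "\<forall>\<^sub>F N in sequentially. 6 * K * 2 ^ n * real N * (2 / real N) powr (1 + \<epsilon>) < \<epsilon>
      \<and> 2 / real N < \<epsilon> \<and> N > 0"
    by (intro eventually_conj)
  then obtain N where N: "6 * K * 2 ^ n * real N * (2 / real N) powr (1 + \<epsilon>) < \<epsilon>" "2 / real N < \<epsilon>" "N > 0"
    by (auto dest!: eventually_happens)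
  let ?I = "{..<N} \<times> {..<N}"
  \<comment> \<open>For a square that misses \<open>F\<close> this is an arbitrary number; no level set in \<open>F\<close> meets it.\<close>
  define c where "c q = g (SOME x. x \<in> F \<inter> grid_square N q)" for q
  define J where "J q = cball (c q) (3 * K / N)" for q
  define M where "M r = (\<Sum>q\<in>?I. indicator (J q) r :: ennreal)" for r
  have M_meas: "M \<in> borel_measurable lborel"
    unfolding M_def J_def by (intro borel_measurable_sum borel_measurable_indicator) auto
  define B where "B = {r \<in> space lborel. 1 \<le> ennreal (1 / (6 * K * 2 ^ n * N)) * M r}"
  have "emeasure lborel B \<le> ennreal (1 / (6 * K * 2 ^ n * N)) * (\<integral>\<^sup>+ r. M r \<partial>lborel)"
    using nn_integral_Markov_inequality[of M UNIV lborel "ennreal (1 / (6 * K * 2 ^ n * N))"] M_meas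
    by (simp add: B_def)
  also have "(\<integral>\<^sup>+ r. M r \<partial>lborel) = (\<Sum>q\<in>?I. emeasure lborel (J q))"
    unfolding M_def by (subst nn_integral_sum) (auto simp: J_def intro!: borel_measurable_indicator)
  also have "\<dots> = (\<Sum>q\<in>?I. ennreal (6 * K / N))"
    using K by (intro sum.cong refl) (auto simp: J_def cball_eq_atLeastAtMost)
  also have "\<dots> = ennreal (6 * K * N)"
    using N(3) K by (simp add: ennreal_of_nat_eq_real_of_nat flip: ennreal_mult)
  also have "ennreal (1 / (6 * K * 2 ^ n * N)) * ennreal (6 * K * N) = ennreal ((1/2) ^ n)"
    using N(3) K by (simp add: power_one_over flip: ennreal_mult)
  finally have B: "emeasure lborel B \<le> ennreal ((1/2) ^ n)" .
  have "hausdorff_premeasure \<epsilon> (1 + \<epsilon>) {x \<in> F. h x = r} \<le> ennreal \<epsilon>"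
    if h: "\<And>x. x \<in> F \<Longrightarrow> \<bar>h x - g x\<bar> \<le> 1 / N" and r: "r \<notin> B" for h r
  proof -
    let ?S = "{q \<in> ?I. r \<in> J q}"
    have cover: "{x \<in> F. h x = r} \<subseteq> \<Union>(grid_square N ` ?S)"
    proof
      fix x assume x: "x \<in> {x \<in> F. h x = r}"
      then obtain q where q: "q \<in> ?I" "x \<in> grid_square N q"
        using grid_square_cover[OF N(3)] F by blast
      define w where "w = (SOME x. x \<in> F \<inter> grid_square N q)"
      have "w \<in> F \<inter> grid_square N q"
        unfolding w_def by (rule someI[of _ x]) (use x q in simp)
      then have w: "w \<in> F" "dist x w \<le> 2 / N"
        using grid_square_dist[OF N(3) q(2)] by auto
      have "\<bar>g x - g w\<bar> \<le> K * dist x w"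
        using x w(1) by (intro g) auto
      also have "\<dots> \<le> K * (2 / N)"
        using w(2) K by (intro mult_left_mono) auto
      finally have "\<bar>g x - c q\<bar> \<le> K * (2 / N)"
        by (simp add: c_def w_def)
      moreover have "\<bar>r - g x\<bar> \<le> K * (1 / N)"
      proof -
        have "1 / real N \<le> K * (1 / N)"
          using K mult_right_mono[of 1 K "1 / N"] by simp
        with h[of x] x show ?thesis by simp
      qed
      ultimately have "\<bar>r - c q\<bar> \<le> 3 * K / N" by simp
      then have "q \<in> ?S"
        using q(1) by (simp add: J_def dist_real_def abs_minus_commute)
      with q(2) show "x \<in> \<Union>(grid_square N ` ?S)" by blast
    qed
    have "M r = ennreal (card ?S)"
      unfolding M_def by (subst sum_indicator_eq_card) (auto simp: ennreal_of_nat_eq_real_of_nat)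
    then have "ennreal (1 / (6 * K * 2 ^ n * N)) * ennreal (card ?S) < 1"
      using r by (simp add: B_def)
    then have "ennreal (1 / (6 * K * 2 ^ n * N) * card ?S) < ennreal 1"
      using K by (subst ennreal_mult) auto
    then have "1 / (6 * K * 2 ^ n * N) * card ?S < 1"
      by (subst (asm) ennreal_less_iff) (use K in auto)
    then have card: "card ?S \<le> 6 * K * 2 ^ n * N"
      using K N(3) by (simp add: field_simps)
    have "card (grid_square N ` ?S) \<le> card ?S"
      by (intro card_image_le) auto
    with card have card': "card (grid_square N ` ?S) \<le> 6 * K * 2 ^ n * N"
      by linarith
    have "hausdorff_premeasure \<epsilon> (1 + \<epsilon>) {x \<in> F. h x = r}
        \<le> hausdorff_premeasure (2 / N) (1 + \<epsilon>) {x \<in> F. h x = r}"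
      by (rule hausdorff_premeasure_mono) (use N(2) \<open>0 < \<epsilon>\<close> \<open>\<epsilon> \<le> 1\<close> in linarith)+
    also have "\<dots> \<le> ennreal (card (grid_square N ` ?S) * (2 / N) powr (1 + \<epsilon>))"
    proof (rule hausdorff_premeasure_finite_cover[OF _ _ _ cover])
      fix U assume "U \<in> grid_square N ` ?S"
      then obtain q where q: "U = grid_square N q" by blast
      then have "bounded U"
        by (auto simp: grid_square_def split: prod.splits intro!: bounded_Times)
      moreover have "diameter U \<le> 2 / N"
        using grid_square_dist[OF N(3)] unfolding q dist_norm by (intro diameter_le) auto
      ultimately show "bounded U \<and> diameter U \<le> 2 / N" ..
    qed (use N \<open>0 < \<epsilon>\<close> in auto)
    also have "\<dots> \<le> ennreal (6 * K * 2 ^ n * N * (2 / N) powr (1 + \<epsilon>))"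
      using card' by (intro ennreal_leI mult_right_mono) auto
    also have "\<dots> \<le> ennreal \<epsilon>"
      using N(1) by (intro ennreal_leI) auto
    finally show ?thesis .
  qed
  moreover have "B \<in> sets lborel"
    unfolding B_def using M_meas by measurable
  ultimately show thesis
    using that[of "1 / real N" B] B N(3) by simp
qed

text \<open>
  A generic function satisfies the preceding covering estimate for every \<open>n\<close> and with \<open>\<epsilon> = 1/(n+1)\<close>.
  By the Borel--Cantelli lemma almost every level lies in only finitely many of the exceptional
  sets, and its level set has vanishing \<open>s\<close>-dimensional premeasures for all \<open>s > 1\<close>.
\<close>

lemma D_lower_le_1:
  fixes F :: "(real \<times> real) set"
  assumes F: "F \<noteq> {}" "F \<subseteq> {0..1} \<times> {0..1}" and \<alpha>: "0 < \<alpha>" "\<alpha> \<le> 1"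
  shows "D_lower \<alpha> F \<le> 1"
proof -
  have bF: "bounded F"
    using F(2) by (rule bounded_subset[rotated]) (auto intro!: bounded_Times)
  define Q where "Q n h B \<longleftrightarrow> B \<in> sets lborel \<and> emeasure lborel B \<le> ennreal ((1/2) ^ n) \<and>
    (\<forall>r. r \<notin> B \<longrightarrow> hausdorff_premeasure (1 / Suc n) (1 + 1 / Suc n) {x \<in> F. h x = r} \<le> ennreal (1 / Suc n))"
    for n :: nat and h :: "real \<times> real \<Rightarrow> real" and B :: "real set"
  have bound: "D_lower_fun f F \<le> ereal 1" if "\<And>n. \<exists>B. Q n f B" for f
  proof -
    obtain B where Q: "\<And>n. Q n f (B n)"
      using \<open>\<And>n. \<exists>B. Q n f B\<close> by metis
    then have B: "\<And>n. B n \<in> sets lborel" "\<And>n. emeasure lborel (B n) \<le> ennreal ((1/2) ^ n)"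
      and cov: "\<And>n r. r \<notin> B n \<Longrightarrow>
        hausdorff_premeasure (1 / Suc n) (1 + 1 / Suc n) {x \<in> F. f x = r} \<le> ennreal (1 / Suc n)"
      unfolding Q_def by blast+
    have fin: "emeasure lborel (B n) < \<infinity>" for n
      using B(2)[of n] by (simp add: le_less_trans)
    have "measure lborel (B n) \<le> (1/2) ^ n" for n
      using B(2)[of n] fin[of n] by (simp add: emeasure_eq_ennreal_measure)
    then have "summable (\<lambda>n. measure lborel (B n))"
      by (intro summable_comparison_test'[OF summable_geometric[of "1/2 :: real"]]) auto
    then have ae: "AE r in lborel. \<forall>\<^sub>F n in sequentially. r \<in> space lborel - B n"
      using B(1) fin by (intro borel_cantelli_AE1) auto
    have dim: "level_dim f r F \<le> ereal 1"
      if r: "\<forall>\<^sub>F n in sequentially. r \<in> space lborel - B n" for r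
    proof (rule ereal_le_epsilon2)
      fix \<eta> :: real assume "\<eta> > 0"
      have "hausdorff_dim {x \<in> F. f x = r} \<le> ereal (1 + \<eta>)"
      proof (rule hausdorff_dim_leI)
        fix \<delta> \<epsilon> :: real assume "\<delta> > 0" "\<epsilon> > 0"
        have "(\<lambda>n. 1 / real (Suc n)) \<longlonglongrightarrow> 0"
          by real_asymp
        then have "\<forall>\<^sub>F n in sequentially. 1 / real (Suc n) < min \<eta> (min \<delta> \<epsilon>)"
          using \<open>\<delta> > 0\<close> \<open>\<epsilon> > 0\<close> \<open>\<eta> > 0\<close> by (intro order_tendstoD) auto
        with r obtain n where n: "r \<notin> B n" "1 / real (Suc n) < min \<eta> (min \<delta> \<epsilon>)"
          using eventually_happens[OF eventually_conj] by fastforce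
        have "hausdorff_premeasure \<delta> (1 + \<eta>) {x \<in> F. f x = r}
            \<le> hausdorff_premeasure (1 / Suc n) (1 + 1 / Suc n) {x \<in> F. f x = r}"
          using n(2) by (intro hausdorff_premeasure_mono add_pos_nonneg) auto
        also have "\<dots> \<le> ennreal (1 / Suc n)"
          by (rule cov[OF n(1)])
        also have "\<dots> \<le> ennreal \<epsilon>"
          using n(2) by (intro ennreal_leI) auto
        finally show "hausdorff_premeasure \<delta> (1 + \<eta>) {x \<in> F. f x = r} \<le> ennreal \<epsilon>" .
      qed (use \<open>\<eta> > 0\<close> in auto)
      then show "level_dim f r F \<le> ereal 1 + ereal \<eta>"
        by (simp add: level_dim_def)
    qed
    have "AE r in lborel. level_dim f r F \<le> ereal 1"
      using ae by (rule AE_mp) (use dim in auto)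
    then obtain N where N: "{r \<in> space lborel. \<not> level_dim f r F \<le> ereal 1} \<subseteq> N" "N \<in> null_sets lborel"
      by (auto elim!: AE_E simp: null_sets_def)
    show ?thesis
      using N by (intro D_lower_fun_leI[of N]) auto
  qed
  have "(INF f\<in>G. D_lower_fun f F) \<le> ereal 1" if G: "G \<in> dense_gdeltas \<alpha> F" for G
  proof -
    have "\<exists>f\<in>G. holder_on 1 \<alpha> F f \<and> (\<forall>n. \<exists>B. Q n f B)"
    proof (rule generic_holder_property[OF F(1) bF \<alpha>(1) G])
      fix n f and \<epsilon> :: real
      assume f: "holder_on 1 \<alpha> F f" "0 < \<epsilon>"
      obtain g K where gK: "0 < K" "holder_on 1 \<alpha> F g"
          "\<And>x y. x \<in> F \<Longrightarrow> y \<in> F \<Longrightarrow> \<bar>g x - g y\<bar> \<le> K * dist x y" "\<And>x. x \<in> F \<Longrightarrow> \<bar>f x - g x\<bar> \<le> \<epsilon>"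
        using holder_lipschitz_approximation[OF \<alpha> f] by metis
      have "\<bar>g x - g y\<bar> \<le> max 1 K * dist x y" if "x \<in> F" "y \<in> F" for x y
        using gK(3)[OF that] by (rule order.trans) (intro mult_right_mono, auto)
      then obtain \<delta> B where \<delta>: "0 < \<delta>" and B: "B \<in> sets lborel" "emeasure lborel B \<le> ennreal ((1/2) ^ n)"
        "\<And>h r. (\<And>x. x \<in> F \<Longrightarrow> \<bar>h x - g x\<bar> \<le> \<delta>) \<Longrightarrow> r \<notin> B \<Longrightarrow>
           hausdorff_premeasure (1 / Suc n) (1 + 1 / Suc n) {x \<in> F. h x = r} \<le> ennreal (1 / Suc n)"
        using lipschitz_level_sets_cover[OF F(2), of "max 1 K" g "1 / Suc n" n thesis] by auto
      have "\<exists>B. Q n h B" if "\<forall>x\<in>F. \<bar>h x - g x\<bar> \<le> \<delta>" for h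
        unfolding Q_def using B that by blast
      then show "\<exists>g \<delta>. holder_on 1 \<alpha> F g \<and> (\<forall>x\<in>F. \<bar>f x - g x\<bar> \<le> \<epsilon>) \<and> 0 < \<delta> \<and>
          (\<forall>h. holder_on 1 \<alpha> F h \<and> (\<forall>x\<in>F. \<bar>h x - g x\<bar> \<le> \<delta>) \<longrightarrow> (\<exists>B. Q n h B))"
        using gK(2,4) \<delta> by blast
    qed
    then obtain f where "f \<in> G" "\<And>n. \<exists>B. Q n f B" by blast
    then show ?thesis
      using bound by (auto intro: INF_lower2)
  qed
  then show ?thesis
    unfolding D_lower_def using \<alpha> by (auto intro!: SUP_least simp: one_ereal_def)
qed

section \<open>Exponents below one half: generic null images\<close>

definition square_corner :: "nat \<Rightarrow> real \<times> real \<Rightarrow> real \<times> real" where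
  "square_corner n p = (cell_corner n (fst p), cell_corner n (snd p))"

lemma square_corner_in:
  "p \<in> fat_cantor \<times> fat_cantor \<Longrightarrow> square_corner n p \<in> fat_cantor \<times> fat_cantor"
  by (auto simp: square_corner_def cell_corner_in_fat_cantor)

lemma square_corner_dist:
  assumes "p \<in> fat_cantor \<times> fat_cantor"
  shows "dist p (square_corner n p) \<le> 2 * fat_len n"
  using dist_pair_le[of p "square_corner n p"] assms
    cell_corner[of "fst p" n] cell_corner[of "snd p" n] by (auto simp: square_corner_def)

lemma distinct_squares_dist:
  assumes "p \<in> fat_cantor \<times> fat_cantor" "q \<in> fat_cantor \<times> fat_cantor"
    and "square_corner n p \<noteq> square_corner n q"
  shows "(fat_len n)\<^sup>2 \<le> dist p q"
proof -
  have "(fat_len n)\<^sup>2 \<le> dist (fst p) (fst q) \<or> (fat_len n)\<^sup>2 \<le> dist (snd p) (snd q)"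
    using assms distinct_cells_dist[of "fst p" "fst q" n] distinct_cells_dist[of "snd p" "snd q" n]
    by (auto simp: square_corner_def dist_real_def)
  then show ?thesis
    using dist_fst_le[of p q] dist_snd_le[of p q] by linarith
qed

lemma finite_square_corner_image: "finite (square_corner n ` (fat_cantor \<times> fat_cantor))"
proof (rule finite_subset)
  show "square_corner n ` (fat_cantor \<times> fat_cantor) \<subseteq> left_ends n \<times> left_ends n"
    by (auto simp: square_corner_def cell_corner)
qed simp

text \<open>
  Let \<open>g\<close> be \<open>K\<close>-Lipschitz and \<open>a < 1\<close>. Rounding the argument of \<open>a g\<close> to the corner of its square
  of level \<open>n\<close> moves it by at most \<open>2l\<^sub>n\<close>. At distances \<open>t\<close> large compared with \<open>l\<^sub>n\<close>, the
  factor \<open>a\<close> absorbs this in the Hoelder condition. At smaller distances the increments are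
  \<open>O(K l\<^sub>n)\<close>, while points in different squares satisfy \<open>t\<^sup>\<alpha> \<ge> l\<^sub>n\<^sup>2\<^sup>\<alpha>\<close>, which is much larger
  because \<open>2\<alpha> < 1\<close>.
\<close>

lemma rounding_preserves_holder:
  assumes \<alpha>: "0 < \<alpha>" "\<alpha> < 1/2" and a: "0 < a" "a < 1" and K: "0 < K"
    and g: "holder_on 1 \<alpha> (fat_cantor \<times> fat_cantor) g"
    and lip: "\<And>x y. x \<in> fat_cantor \<times> fat_cantor \<Longrightarrow> y \<in> fat_cantor \<times> fat_cantor \<Longrightarrow>
      \<bar>g x - g y\<bar> \<le> K * dist x y"
  shows "\<forall>\<^sub>F n in sequentially. holder_on 1 \<alpha> (fat_cantor \<times> fat_cantor) (\<lambda>p. a * g (square_corner n p))"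
proof -
  \<comment> \<open>For \<open>t \<ge> c l\<^sub>n\<close> one has \<open>t + 4l\<^sub>n \<le> t/a\<close>, and \<open>a (t/a)\<^sup>\<alpha> \<le> t\<^sup>\<alpha>\<close>.\<close>
  define c where "c = 4 / (1 / a - 1)"
  have c: "c > 0"
    using a by (simp add: c_def)
  have "((\<lambda>n. K * (c + 4) * fat_len n powr (1 - 2 * \<alpha>)) \<longlongrightarrow> K * (c + 4) * 0) sequentially"
    using \<alpha> fat_len_tendsto_0 fat_len_pos
    by (intro tendsto_intros tendsto_zero_powrI[OF _ tendsto_const]) (auto simp: less_imp_le)
  then have "\<forall>\<^sub>F n in sequentially. K * (c + 4) * fat_len n powr (1 - 2 * \<alpha>) < 1"
    by (rule order_tendstoD) simp
  then show ?thesis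
  proof eventually_elim
    case (elim n)
    let ?l = "fat_len n" and ?q = "square_corner n"
    have l: "?l > 0" by (rule fat_len_pos)
    have "?l powr 1 = ?l powr (1 - 2 * \<alpha>) * ?l powr (2 * \<alpha>)"
      by (simp flip: powr_add)
    then have "K * (c + 4) * ?l = K * (c + 4) * ?l powr (1 - 2 * \<alpha>) * ?l powr (2 * \<alpha>)"
      using l by simp
    also have "\<dots> \<le> 1 * ?l powr (2 * \<alpha>)"
      using elim by (intro mult_right_mono) auto
    also have "?l powr (2 * \<alpha>) = (?l\<^sup>2) powr \<alpha>"
      using l by (simp add: powr_powr flip: powr_numeral)
    finally have small: "K * (c + 4) * ?l \<le> (?l\<^sup>2) powr \<alpha>" by simp
    show ?case
      unfolding holder_on_def
    proof (intro ballI)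
      fix x y assume xy: "x \<in> fat_cantor \<times> fat_cantor" "y \<in> fat_cantor \<times> fat_cantor"
      let ?t = "dist x y" and ?s = "dist (?q x) (?q y)"
      have q: "?q x \<in> fat_cantor \<times> fat_cantor" "?q y \<in> fat_cantor \<times> fat_cantor"
        using xy square_corner_in by auto
      have "?s \<le> dist (?q x) x + ?t + dist y (?q y)"
        using dist_triangle[of "?q x" "?q y" x] dist_triangle[of x "?q y" y] by linarith
      then have s: "?s \<le> ?t + 4 * ?l"
        using square_corner_dist[OF xy(1), of n] square_corner_dist[OF xy(2), of n]
        by (simp add: dist_commute)
      have eq: "\<bar>a * g (?q x) - a * g (?q y)\<bar> = a * \<bar>g (?q x) - g (?q y)\<bar>"
        using a by (simp add: abs_mult flip: right_diff_distrib)
      consider "?q x = ?q y" | "?q x \<noteq> ?q y" "?t < c * ?l" | "c * ?l \<le> ?t"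
        by linarith
      then have "a * \<bar>g (?q x) - g (?q y)\<bar> \<le> ?t powr \<alpha>"
      proof cases
        case 2
        have "a * \<bar>g (?q x) - g (?q y)\<bar> \<le> 1 * (K * ?s)"
          using lip[OF q] a by (intro mult_mono) auto
        also have "\<dots> \<le> K * ((c + 4) * ?l)"
          using s 2(2) K by (simp add: distrib_right)
        also have "\<dots> \<le> (?l\<^sup>2) powr \<alpha>"
          using small by (simp add: mult.assoc)
        also have "\<dots> \<le> ?t powr \<alpha>"
          using distinct_squares_dist[OF xy 2(1)] \<alpha> by (intro powr_mono2) auto
        finally show ?thesis .
      next
        case 3
        have "4 * ?l \<le> (1 / a - 1) * ?t"
          using 3 a by (simp add: c_def field_simps)
        then have "?s \<le> ?t / a"
          using s by (simp add: left_diff_distrib)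
        have "a * \<bar>g (?q x) - g (?q y)\<bar> \<le> a * ?s powr \<alpha>"
          using holder_onD[OF g q] a by (intro mult_left_mono) auto
        also have "\<dots> \<le> a * (?t / a) powr \<alpha>"
          using \<open>?s \<le> ?t / a\<close> a \<alpha> by (intro mult_left_mono powr_mono2) auto
        also have "\<dots> = a powr (1 - \<alpha>) * ?t powr \<alpha>"
          using a by (simp add: powr_divide powr_diff)
        also have "\<dots> \<le> 1 * ?t powr \<alpha>"
          using a \<alpha> by (intro mult_right_mono powr_le1) auto
        finally show ?thesis by simp
      qed auto
      with eq show "\<bar>a * g (?q x) - a * g (?q y)\<bar> \<le> 1 * ?t powr \<alpha>" by simp
    qed
  qed
qed

lemma holder_finite_range_approximation:
  fixes f :: "real \<times> real \<Rightarrow> real"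
  defines "F \<equiv> fat_cantor \<times> fat_cantor"
  assumes \<alpha>: "0 < \<alpha>" "\<alpha> < 1/2" and f: "holder_on 1 \<alpha> F f" and \<epsilon>: "0 < \<epsilon>"
  obtains h where "holder_on 1 \<alpha> F h" "finite (h ` F)" "\<And>x. x \<in> F \<Longrightarrow> \<bar>f x - h x\<bar> \<le> \<epsilon>"
proof -
  have bF: "bounded F"
    using bounded_fat_cantor_square by (simp add: F_def)
  obtain B where B: "B > 0" "\<And>x. x \<in> F \<Longrightarrow> \<bar>f x\<bar> \<le> B"
    using holder_bounded[OF f bF \<alpha>(1)] by blast
  define a where "a = 1 - min (1/2) (\<epsilon> / (3 * B))"
  have a: "0 < a" "a < 1" "(1 - a) * B \<le> \<epsilon> / 3"
    using \<epsilon> B(1) by (auto simp: a_def min_def field_simps)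
  have "\<alpha> \<le> 1" "\<epsilon> / 3 > 0"
    using \<alpha> \<epsilon> by auto
  then obtain g K where g: "0 < K" "holder_on 1 \<alpha> F g"
      "\<And>x y. x \<in> F \<Longrightarrow> y \<in> F \<Longrightarrow> \<bar>g x - g y\<bar> \<le> K * dist x y" "\<And>x. x \<in> F \<Longrightarrow> \<bar>f x - g x\<bar> \<le> \<epsilon> / 3"
    using holder_lipschitz_approximation[OF \<alpha>(1) _ f] by metis
  have "(\<lambda>n. K * (2 * fat_len n)) \<longlonglongrightarrow> K * (2 * 0)"
    by (intro tendsto_intros fat_len_tendsto_0)
  then have "\<forall>\<^sub>F n in sequentially. K * (2 * fat_len n) < \<epsilon> / 3"
    using \<epsilon> by (intro order_tendstoD) auto
  moreover have "\<forall>\<^sub>F n in sequentially. holder_on 1 \<alpha> F (\<lambda>p. a * g (square_corner n p))"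
    unfolding F_def by (rule rounding_preserves_holder[OF \<alpha> a(1,2) g(1-3)[unfolded F_def]])
  ultimately obtain n where n: "K * (2 * fat_len n) < \<epsilon> / 3"
      "holder_on 1 \<alpha> F (\<lambda>p. a * g (square_corner n p))"
    using eventually_happens[OF eventually_conj] by fastforce
  show thesis
  proof (rule that[OF n(2)])
    have "(\<lambda>p. a * g (square_corner n p)) ` F = (\<lambda>p. a * g p) ` square_corner n ` F"
      by (simp add: image_image)
    then show "finite ((\<lambda>p. a * g (square_corner n p)) ` F)"
      using finite_square_corner_image by (simp add: F_def)
    fix x assume x: "x \<in> F"
    let ?q = "square_corner n x"
    have "?q \<in> F"
      using x square_corner_in by (simp add: F_def)
    then have "\<bar>g x - g ?q\<bar> \<le> K * dist x ?q"
      using g(3) x by blast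
    also have "\<dots> \<le> K * (2 * fat_len n)"
      using g(1) x square_corner_dist by (intro mult_left_mono) (auto simp: F_def)
    finally have 1: "\<bar>g x - g ?q\<bar> \<le> \<epsilon> / 3" using n(1) by linarith
    have 2: "\<bar>f x - g x\<bar> \<le> \<epsilon> / 3" using g(4)[OF x] .
    have "(1 - a) * \<bar>f x\<bar> \<le> (1 - a) * B"
      using a B(2)[OF x] by (intro mult_left_mono) auto
    then have "(1 - a) * \<bar>f x\<bar> \<le> \<epsilon> / 3"
      using a(3) by linarith
    then have 3: "\<bar>(1 - a) * f x\<bar> \<le> \<epsilon> / 3"
      using a(2) by (simp add: abs_mult)
    have "\<bar>f x - g ?q\<bar> \<le> 2 * \<epsilon> / 3"
      using 1 2 by linarith
    then have "a * \<bar>f x - g ?q\<bar> \<le> 1 * (2 * \<epsilon> / 3)"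
      using a(1,2) by (intro mult_mono) auto
    then have 4: "\<bar>a * (f x - g ?q)\<bar> \<le> 2 * \<epsilon> / 3"
      using a by (simp add: abs_mult)
    have "f x - a * g ?q = (1 - a) * f x + a * (f x - g ?q)"
      by (simp add: algebra_simps)
    then show "\<bar>f x - a * g ?q\<bar> \<le> \<epsilon>"
      using 3 4 by linarith
  qed
qed

text \<open>
  A function that is uniformly close to one with finite range has its range in a finite union of
  short intervals, so a generic function has a null range and almost every level set is empty.
\<close>

lemma D_lower_eq_0:
  assumes \<alpha>: "0 < \<alpha>" "\<alpha> < 1/2"
  shows "D_lower \<alpha> (fat_cantor \<times> fat_cantor) = 0"
proof (rule antisym)
  let ?F = "fat_cantor \<times> fat_cantor"
  have F: "?F \<noteq> {}" "bounded ?F"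
    using zero_in_fat_cantor bounded_fat_cantor_square by auto
  define P where "P n h \<longleftrightarrow> (\<exists>B\<in>sets lborel. emeasure lborel B \<le> ennreal (1 / Suc n) \<and> h ` ?F \<subseteq> B)"
    for n :: nat and h :: "real \<times> real \<Rightarrow> real"
  have bound: "D_lower_fun f ?F \<le> ereal 0" if P: "\<And>n. P n f" for f
  proof -
    obtain B where B: "\<And>n. B n \<in> sets lborel" "\<And>n. emeasure lborel (B n) \<le> ennreal (1 / Suc n)"
        "\<And>n. f ` ?F \<subseteq> B n"
      using P unfolding P_def by metis
    define N where "N = (\<Inter>n. B n)"
    have "emeasure lborel N \<le> 0 + ennreal \<epsilon>" if "\<epsilon> > 0" for \<epsilon>
    proof -
      obtain n where n: "1 / real (Suc n) < \<epsilon>"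
        using nat_approx_posE[OF \<open>\<epsilon> > 0\<close>] by metis
      have "emeasure lborel N \<le> emeasure lborel (B n)"
        using B(1) by (intro emeasure_mono) (auto simp: N_def)
      also have "\<dots> \<le> ennreal (1 / Suc n)"
        by (rule B(2))
      also have "\<dots> \<le> ennreal \<epsilon>"
        using n by (intro ennreal_leI) auto
      finally show ?thesis by simp
    qed
    then have "emeasure lborel N \<le> 0"
      by (rule ennreal_le_epsilon)
    moreover have "N \<in> sets lborel"
      using B(1) by (auto simp: N_def)
    ultimately have "N \<in> null_sets lborel"
      by (auto simp: null_sets_def)
    moreover have "level_dim f r ?F \<le> ereal 0" if "r \<notin> N" for r
    proof -
      have "{x \<in> ?F. f x = r} = {}"
        using that B(3) by (auto simp: N_def)
      then show ?thesis
        by (simp only: level_dim_def hausdorff_dim_empty) simp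
    qed
    ultimately show ?thesis
      by (rule D_lower_fun_leI)
  qed
  have "(INF f\<in>G. D_lower_fun f ?F) \<le> ereal 0" if G: "G \<in> dense_gdeltas \<alpha> ?F" for G
  proof -
    have "\<exists>f\<in>G. holder_on 1 \<alpha> ?F f \<and> (\<forall>n. P n f)"
    proof (rule generic_holder_property[OF F \<alpha>(1) G])
      fix n f and \<epsilon> :: real
      assume f: "holder_on 1 \<alpha> ?F f" "0 < \<epsilon>"
      obtain g where g: "holder_on 1 \<alpha> ?F g" "finite (g ` ?F)" "\<And>x. x \<in> ?F \<Longrightarrow> \<bar>f x - g x\<bar> \<le> \<epsilon>"
        using holder_finite_range_approximation[OF \<alpha> f] by metis
      define k where "k = card (g ` ?F)"
      define \<delta> where "\<delta> = 1 / ((real k + 1) * Suc n) / 2"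
      have \<delta>: "\<delta> > 0" by (simp add: \<delta>_def)
      define B where "B = (\<Union>v\<in>g ` ?F. cball v \<delta>)"
      have "emeasure lborel B \<le> (\<Sum>v\<in>g ` ?F. emeasure lborel (cball v \<delta>))"
        unfolding B_def using g(2) by (intro emeasure_subadditive_finite) auto
      also have "\<dots> = ennreal (k * (2 * \<delta>))"
        using \<delta> by (simp add: cball_eq_atLeastAtMost k_def ennreal_of_nat_eq_real_of_nat flip: ennreal_mult)
      also have "k * (2 * \<delta>) = real k / (real k + 1) * (1 / Suc n)"
        by (simp add: \<delta>_def)
      also have "ennreal \<dots> \<le> ennreal (1 * (1 / Suc n))"
        by (intro ennreal_leI mult_right_mono) auto
      finally have "emeasure lborel B \<le> ennreal (1 / Suc n)" by simp
      moreover have "B \<in> sets lborel"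
        unfolding B_def using g(2) by (intro sets.finite_UN) simp_all
      moreover have "h ` ?F \<subseteq> B" if "\<forall>x\<in>?F. \<bar>h x - g x\<bar> \<le> \<delta>" for h
        using that by (fastforce simp: B_def dist_real_def abs_minus_commute)
      ultimately have "P n h" if "\<forall>x\<in>?F. \<bar>h x - g x\<bar> \<le> \<delta>" for h
        unfolding P_def using that by blast
      then show "\<exists>g \<delta>. holder_on 1 \<alpha> ?F g \<and> (\<forall>x\<in>?F. \<bar>f x - g x\<bar> \<le> \<epsilon>) \<and> 0 < \<delta> \<and>
          (\<forall>h. holder_on 1 \<alpha> ?F h \<and> (\<forall>x\<in>?F. \<bar>h x - g x\<bar> \<le> \<delta>) \<longrightarrow> P n h)"
        using g \<delta> by blast
    qed
    then obtain f where "f \<in> G" "\<And>n. P n f" by blast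
    then show ?thesis
      using bound by (auto intro: INF_lower2)
  qed
  then show "D_lower \<alpha> ?F \<le> 0"
    unfolding D_lower_def using \<alpha> by (auto intro!: SUP_least simp: zero_ereal_def)
  have "{f \<in> mspace (holder1_space \<alpha> ?F). True} \<in> dense_gdeltas \<alpha> ?F"
    using F \<alpha> by (intro dense_open_in_dense_gdeltas) (auto intro: exI[of _ 1] exI[of _ f for f])
  then show "0 \<le> D_lower \<alpha> ?F"
    unfolding D_lower_def using \<alpha>
    by (auto intro!: SUP_upper2 INF_greatest D_lower_fun_nonneg)
qed

section \<open>Exponents above one half: large images of rows\<close>

lemma closed_segment_split:
  fixes a b c :: real
  shows "closed_segment a b \<subseteq> closed_segment a c \<union> closed_segment c b"
  by (auto simp: closed_segment_eq_real_ivl)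

text \<open>
  Splitting an interval of some level repeatedly: a value between those at its endpoints lies
  between the values at the ends of one of its subintervals of a deeper level, or of one of the
  gaps removed on the way.
\<close>

lemma cell_segment_subset:
  fixes f :: "real \<Rightarrow> real"
  shows "closed_segment (f 0) (f (fat_len m)) \<subseteq>
    (\<Union>t\<in>cell_offsets m k. closed_segment (f t) (f (t + fat_len (m + k)))) \<union>
    (\<Union>j<k. \<Union>t\<in>cell_offsets m j.
       closed_segment (f (t + fat_len (m + Suc j))) (f (t + fat_len (m + j) - fat_len (m + Suc j))))"
proof (induction k)
  case (Suc k)
  define d where "d = fat_len (m + k) - fat_len (m + Suc k)"
  have split: "closed_segment (f t) (f (t + fat_len (m + k))) \<subseteq>
      closed_segment (f t) (f (t + fat_len (m + Suc k))) \<union>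
      closed_segment (f (t + fat_len (m + Suc k))) (f (t + d)) \<union>
      closed_segment (f (t + d)) (f (t + d + fat_len (m + Suc k)))" for t
  proof -
    have "t + fat_len (m + k) = t + d + fat_len (m + Suc k)"
      by (simp add: d_def)
    then show ?thesis
      using closed_segment_split[of "f t" "f (t + fat_len (m + k))" "f (t + fat_len (m + Suc k))"]
        closed_segment_split[of "f (t + fat_len (m + Suc k))" "f (t + fat_len (m + k))" "f (t + d)"]
      by (simp only:) blast
  qed
  have offs: "cell_offsets m (Suc k) = cell_offsets m k \<union> (\<lambda>t. t + d) ` cell_offsets m k"
    by (simp add: d_def)
  have d: "t + fat_len (m + k) - fat_len (m + Suc k) = t + d" for t
    by (simp add: d_def)
  show ?case
  proof
    fix r assume "r \<in> closed_segment (f 0) (f (fat_len m))"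
    with Suc.IH have "r \<in> (\<Union>t\<in>cell_offsets m k. closed_segment (f t) (f (t + fat_len (m + k)))) \<union>
      (\<Union>j<k. \<Union>t\<in>cell_offsets m j.
        closed_segment (f (t + fat_len (m + Suc j))) (f (t + fat_len (m + j) - fat_len (m + Suc j))))"
      by blast
    then consider t where "t \<in> cell_offsets m k" "r \<in> closed_segment (f t) (f (t + fat_len (m + k)))"
      | j t where "j < k" "t \<in> cell_offsets m j"
        "r \<in> closed_segment (f (t + fat_len (m + Suc j))) (f (t + fat_len (m + j) - fat_len (m + Suc j)))"
      by blast
    then show "r \<in> (\<Union>t\<in>cell_offsets m (Suc k). closed_segment (f t) (f (t + fat_len (m + Suc k)))) \<union>
      (\<Union>j<Suc k. \<Union>t\<in>cell_offsets m j.
        closed_segment (f (t + fat_len (m + Suc j))) (f (t + fat_len (m + j) - fat_len (m + Suc j))))"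
    proof cases
      case 1
      then consider "r \<in> closed_segment (f t) (f (t + fat_len (m + Suc k)))"
        | "r \<in> closed_segment (f (t + fat_len (m + Suc k))) (f (t + d))"
        | "r \<in> closed_segment (f (t + d)) (f (t + d + fat_len (m + Suc k)))"
        using split[of t] by blast
      then show ?thesis
      proof cases
        case 2
        then have "r \<in> closed_segment (f (t + fat_len (m + Suc k))) (f (t + fat_len (m + k) - fat_len (m + Suc k)))"
          by (simp only: d)
        then show ?thesis
          using 1(1) lessI[of k] by blast
      qed (use 1(1) in \<open>(subst offs, blast)+\<close>)
    next
      case 2
      then have "r \<in> (\<Union>j<Suc k. \<Union>t\<in>cell_offsets m j.
        closed_segment (f (t + fat_len (m + Suc j))) (f (t + fat_len (m + j) - fat_len (m + Suc j))))"
        by (intro UN_I[of j] UN_I[of t]) auto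
      then show ?thesis by blast
    qed
  qed
qed auto

lemma cell_offsets_ends:
  assumes "t \<in> cell_offsets m k"
  shows "t \<in> fat_cantor \<inter> {0..fat_len m}" "t + fat_len (m + k) \<in> fat_cantor \<inter> {0..fat_len m}"
proof -
  have "t \<in> left_ends (m + k)"
    using cell_offsets_subset_left_ends assms by blast
  then show "t \<in> fat_cantor \<inter> {0..fat_len m}" "t + fat_len (m + k) \<in> fat_cantor \<inter> {0..fat_len m}"
    using fat_cantor_cell_ends cell_offsets_bounds[OF assms] fat_len_pos[of "m + k"] by auto
qed

lemma cell_offsets_gap_ends:
  assumes "t \<in> cell_offsets m j"
  shows "t + fat_len (m + Suc j) \<in> fat_cantor \<inter> {0..fat_len m}"
    and "t + fat_len (m + j) - fat_len (m + Suc j) \<in> fat_cantor \<inter> {0..fat_len m}"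
proof -
  have "t \<in> cell_offsets m (Suc j)" "t + fat_len (m + j) - fat_len (m + Suc j) \<in> cell_offsets m (Suc j)"
    using assms by auto
  then show "t + fat_len (m + Suc j) \<in> fat_cantor \<inter> {0..fat_len m}"
    and "t + fat_len (m + j) - fat_len (m + Suc j) \<in> fat_cantor \<inter> {0..fat_len m}"
    using cell_offsets_ends by blast+
qed

lemma gap_powr_le:
  assumes "0 < \<alpha>"
  shows "2 ^ j * (fat_len (m + j) * fat_len (m + Suc j)) powr \<alpha>
    \<le> (2 powr (1 - 2 * \<alpha>)) ^ j * fat_len m powr (2 * \<alpha>)"
proof -
  have l: "0 < fat_len i" for i by (rule fat_len_pos)
  have "fat_len (m + Suc j) \<le> fat_len m / 2 ^ j"
    using fat_len_add_le[of m j] fat_len_antimono[of "m + j" "m + Suc j"] by simp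
  then have "fat_len (m + j) * fat_len (m + Suc j) \<le> (fat_len m / 2 ^ j) * (fat_len m / 2 ^ j)"
    using fat_len_add_le[of m j] l by (intro mult_mono) (auto simp: less_imp_le)
  then have "(fat_len (m + j) * fat_len (m + Suc j)) powr \<alpha> \<le> ((fat_len m / 2 ^ j) * (fat_len m / 2 ^ j)) powr \<alpha>"
    using assms l by (intro powr_mono2) (auto simp: less_imp_le)
  also have "\<dots> = (fat_len m / 2 powr j) powr (2 * \<alpha>)"
  proof -
    have sq: "(x * x) powr \<alpha> = x powr (2 * \<alpha>)" if "0 < x" for x :: real
      using that by (simp add: powr_mult) (simp only: mult_2 powr_add)
    have eq: "2 powr real j = (2::real) ^ j"
      by (simp add: powr_realpow)
    show ?thesis
      unfolding eq by (rule sq) (use l[of m] in simp)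
  qed
  also have "\<dots> = fat_len m powr (2 * \<alpha>) * 2 powr (- (2 * \<alpha> * j))"
    using l[of m] by (simp add: powr_divide powr_powr powr_minus_divide mult.commute)
  finally have "2 ^ j * (fat_len (m + j) * fat_len (m + Suc j)) powr \<alpha>
      \<le> 2 ^ j * (fat_len m powr (2 * \<alpha>) * 2 powr (- (2 * \<alpha> * j)))"
    by (intro mult_left_mono) auto
  also have "\<dots> = (2 powr j * 2 powr (- (2 * \<alpha> * j))) * fat_len m powr (2 * \<alpha>)"
    by (simp add: powr_realpow)
  also have "2 powr j * 2 powr (- (2 * \<alpha> * j)) = 2 powr ((1 - 2 * \<alpha>) * j)"
    by (simp add: left_diff_distrib flip: powr_add)
  also have "\<dots> = (2 powr (1 - 2 * \<alpha>)) powr j"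
    by (simp add: powr_powr)
  also have "\<dots> = (2 powr (1 - 2 * \<alpha>)) ^ j"
    by (simp add: powr_realpow)
  finally show ?thesis .
qed

text \<open>
  A value between \<open>f 0\<close> and \<open>f l\<^sub>m\<close> is attained on the Cantor set unless \<open>f\<close> jumps over it
  across a gap. Inside \<open>[0, l\<^sub>m]\<close> there are \<open>2\<^sup>j\<close> gaps of length at most \<open>4\<^sup>-\<^sup>j l\<^sub>m\<^sup>2\<close> for each \<open>j\<close>,
  so the jumps have total size at most \<open>\<Sum>\<^sub>j 2\<^sup>j (4\<^sup>-\<^sup>j l\<^sub>m\<^sup>2)\<^sup>\<alpha>\<close>, a geometric series that converges
  for \<open>\<alpha> > 1/2\<close>.
\<close>

lemma holder_image_measure:
  fixes f :: "real \<Rightarrow> real"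
  assumes \<alpha>: "1/2 < \<alpha>" and f: "holder_on 1 \<alpha> (fat_cantor \<inter> {0..fat_len m}) f"
    and big: "fat_len m powr (2 * \<alpha>) / (1 - 2 powr (1 - 2 * \<alpha>)) < \<bar>f (fat_len m) - f 0\<bar>"
  shows "0 < emeasure lborel (f ` (fat_cantor \<inter> {0..fat_len m}))"
proof (rule ccontr)
  let ?S = "fat_cantor \<inter> {0..fat_len m}"
  let ?I = "f ` ?S"
  assume "\<not> 0 < emeasure lborel ?I"
  then have zero: "emeasure lborel ?I = 0" by simp
  have "compact ?S"
    using compact_fat_cantor by (intro compact_Int) auto
  then have I: "compact ?I"
    using holder_on_imp_continuous_on[OF f] \<alpha> by (intro compact_continuous_image) auto
  \<comment> \<open>The values that \<open>f\<close> may skip at the gaps of level \<open>m + j\<close>.\<close>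
  define J where "J j = (\<Union>t\<in>cell_offsets m j.
    closed_segment (f (t + fat_len (m + Suc j))) (f (t + fat_len (m + j) - fat_len (m + Suc j))))" for j
  have cover: "closed_segment (f 0) (f (fat_len m)) \<subseteq> ?I \<union> (\<Union>j. J j)"
  proof
    fix r assume r: "r \<in> closed_segment (f 0) (f (fat_len m))"
    show "r \<in> ?I \<union> (\<Union>j. J j)"
    proof (cases "r \<in> (\<Union>j. J j)")
      case False
      have near: "\<exists>y\<in>?I. dist y r \<le> fat_len (m + Suc k) powr \<alpha>" for k
      proof -
        have "r \<in> (\<Union>t\<in>cell_offsets m (Suc k). closed_segment (f t) (f (t + fat_len (m + Suc k))))"
          using cell_segment_subset[of f m "Suc k"] r False unfolding J_def by blast
        then obtain t where t: "t \<in> cell_offsets m (Suc k)"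
            "r \<in> closed_segment (f t) (f (t + fat_len (m + Suc k)))"
          by blast
        have S: "t \<in> ?S" "t + fat_len (m + Suc k) \<in> ?S"
          using cell_offsets_ends[OF t(1)] by blast+
        have "dist (f t) r \<le> \<bar>f t - f (t + fat_len (m + Suc k))\<bar>"
          using t(2) by (auto simp: closed_segment_eq_real_ivl dist_real_def split: if_splits)
        also have "\<dots> \<le> fat_len (m + Suc k) powr \<alpha>"
          using holder_onD[OF f S] fat_len_pos[of "m + Suc k"] by (simp add: dist_real_def)
        finally show ?thesis using S(1) by blast
      qed
      have "(\<lambda>k. fat_len (m + Suc k) powr \<alpha>) \<longlonglongrightarrow> 0"
      proof (rule tendsto_zero_powrI[OF _ tendsto_const])
        show "(\<lambda>k. fat_len (m + Suc k)) \<longlonglongrightarrow> 0"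
          using LIMSEQ_ignore_initial_segment[OF fat_len_tendsto_0, of "Suc m"] by (simp add: add.commute)
      qed (use \<alpha> fat_len_pos in \<open>auto simp: less_imp_le\<close>)
      have "r \<in> closure ?I"
        unfolding closure_approachable
      proof (intro allI impI)
        fix \<epsilon> :: real assume "\<epsilon> > 0"
        with \<open>(\<lambda>k. fat_len (m + Suc k) powr \<alpha>) \<longlonglongrightarrow> 0\<close>
        have "\<forall>\<^sub>F k in sequentially. fat_len (m + Suc k) powr \<alpha> < \<epsilon>"
          by (rule order_tendstoD)
        then obtain k where "fat_len (m + Suc k) powr \<alpha> < \<epsilon>"
          by (auto dest!: eventually_happens)
        with near[of k] show "\<exists>y\<in>?I. dist y r < \<epsilon>"
          by (meson le_less_trans)
      qed
      then show ?thesis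
        using compact_imp_closed[OF I] by simp
    qed blast
  qed
  define q where "q = 2 powr (1 - 2 * \<alpha>)"
  have q: "0 < q" "q < 1"
    using \<alpha> by (auto simp: q_def powr_less_one)
  have J_le: "emeasure lborel (J j) \<le> ennreal (q ^ j * fat_len m powr (2 * \<alpha>))" for j
  proof -
    let ?g = "fat_len (m + j) * fat_len (m + Suc j)"
    have "emeasure lborel (J j) \<le> (\<Sum>t\<in>cell_offsets m j. emeasure lborel
       (closed_segment (f (t + fat_len (m + Suc j))) (f (t + fat_len (m + j) - fat_len (m + Suc j)))))"
      unfolding J_def by (intro emeasure_subadditive_finite) (auto simp: closed_segment_eq_real_ivl)
    also have "\<dots> \<le> (\<Sum>t\<in>cell_offsets m j. ennreal (?g powr \<alpha>))"
    proof (intro sum_mono)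
      fix t assume t: "t \<in> cell_offsets m j"
      let ?u = "t + fat_len (m + Suc j)" and ?v = "t + fat_len (m + j) - fat_len (m + Suc j)"
      have "dist ?u ?v = ?g"
        using fat_len_gap[of "m + j", folded add_Suc_right] mult_pos_pos[OF fat_len_pos[of "m + j"] fat_len_pos[of "m + Suc j"]]
        unfolding dist_real_def by linarith
      then have "\<bar>f ?u - f ?v\<bar> \<le> ?g powr \<alpha>"
        using holder_onD[OF f cell_offsets_gap_ends[OF t]] by simp
      then show "emeasure lborel (closed_segment (f ?u) (f ?v)) \<le> ennreal (?g powr \<alpha>)"
        by (auto simp: closed_segment_eq_real_ivl intro!: ennreal_leI)
    qed
    also have "\<dots> = ennreal (card (cell_offsets m j) * ?g powr \<alpha>)"
      by (simp add: ennreal_of_nat_eq_real_of_nat flip: ennreal_mult)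
    also have "\<dots> \<le> ennreal (2 ^ j * ?g powr \<alpha>)"
      using card_cell_offsets[of m j]
      by (intro ennreal_leI mult_right_mono) (auto simp flip: of_nat_power)
    also have "\<dots> \<le> ennreal (q ^ j * fat_len m powr (2 * \<alpha>))"
      unfolding q_def using gap_powr_le[of \<alpha> j m] \<alpha> by (intro ennreal_leI) auto
    finally show ?thesis .
  qed
  have J_meas: "J j \<in> sets lborel" for j
    unfolding J_def by (intro sets.finite_UN) (auto simp: closed_segment_eq_real_ivl)
  have "ennreal \<bar>f (fat_len m) - f 0\<bar> = emeasure lborel (closed_segment (f 0) (f (fat_len m)))"
    by (auto simp: closed_segment_eq_real_ivl)
  also have "\<dots> \<le> emeasure lborel (?I \<union> (\<Union>j. J j))"
    using cover compact_imp_closed[OF I] J_meas by (intro emeasure_mono) auto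
  also have "\<dots> \<le> emeasure lborel ?I + emeasure lborel (\<Union>j. J j)"
    using compact_imp_closed[OF I] J_meas by (intro emeasure_subadditive) auto
  also have "\<dots> = emeasure lborel (\<Union>j. J j)"
    by (simp add: zero)
  also have "\<dots> \<le> (\<Sum>j. emeasure lborel (J j))"
    using J_meas by (intro emeasure_subadditive_countably) auto
  also have "\<dots> \<le> (\<Sum>j. ennreal (q ^ j * fat_len m powr (2 * \<alpha>)))"
    by (intro suminf_le J_le) auto
  also have "\<dots> = ennreal (\<Sum>j. q ^ j * fat_len m powr (2 * \<alpha>))"
    using q by (intro suminf_ennreal2 summable_mult2 summable_geometric) auto
  also have "(\<Sum>j. q ^ j * fat_len m powr (2 * \<alpha>)) = fat_len m powr (2 * \<alpha>) / (1 - q)"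
    using q by (simp add: suminf_mult2[symmetric] summable_geometric suminf_geometric)
  finally have "\<bar>f (fat_len m) - f 0\<bar> \<le> fat_len m powr (2 * \<alpha>) / (1 - q)"
    using q by (subst (asm) ennreal_le_iff) auto
  with big show False
    by (simp add: q_def)
qed

text \<open>The case of the identity map, with exponent \<open>1\<close>.\<close>

lemma fat_cantor_measure_pos:
  assumes "1 \<le> k"
  shows "0 < emeasure lborel (fat_cantor \<inter> {0..fat_len k})"
proof -
  have "fat_len 1 = 1 / 3" by (simp add: fat_len_def)
  then have l: "fat_len k \<le> 1 / 3" "0 < fat_len k"
    using fat_len_antimono[OF assms] fat_len_pos by auto
  have "fat_len k powr (2 * 1) / (1 - 2 powr (1 - 2 * 1)) = 2 * fat_len k * fat_len k"
    using l by (simp add: powr_minus power2_eq_square)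
  also have "\<dots> < 1 * fat_len k"
    using l by (intro mult_strict_right_mono) auto
  finally have "0 < emeasure lborel ((\<lambda>x. x) ` (fat_cantor \<inter> {0..fat_len k}))"
    using l by (intro holder_image_measure[of 1]) (auto simp: holder_on_def dist_real_def)
  then show ?thesis by simp
qed

text \<open>
  In all rows near \<open>y = 0\<close> the increment exceeds the bound on the total size of the jumps across the
  gaps. The constant \<open>c\<close> is the same for all these rows, which leaves room for a uniformly small perturbation.
\<close>

definition steep_rows :: "real \<Rightarrow> (real \<times> real \<Rightarrow> real) \<Rightarrow> bool" where
  "steep_rows \<alpha> f \<longleftrightarrow> (\<exists>m k c. 1 \<le> k \<and> fat_len m powr (2 * \<alpha>) / (1 - 2 powr (1 - 2 * \<alpha>)) < c \<and>
     (\<forall>y \<in> fat_cantor \<inter> {0..fat_len k}. c \<le> \<bar>f (fat_len m, y) - f (0, y)\<bar>))"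

text \<open>
  Each of a set of rows of positive measure has an image of positive measure. By Fubini's theorem
  there is a set of positive measure of levels \<open>r\<close> whose level sets meet a set of rows of positive
  measure; the projection of such a level set has positive length.
\<close>

lemma steep_rows_D_lower_fun:
  assumes \<alpha>: "1/2 < \<alpha>" and f: "holder_on 1 \<alpha> (fat_cantor \<times> fat_cantor) f" and "steep_rows \<alpha> f"
  shows "1 \<le> D_lower_fun f (fat_cantor \<times> fat_cantor)"
proof -
  obtain m k c where mkc: "1 \<le> k" "fat_len m powr (2 * \<alpha>) / (1 - 2 powr (1 - 2 * \<alpha>)) < c"
      "\<And>y. y \<in> fat_cantor \<inter> {0..fat_len k} \<Longrightarrow> c \<le> \<bar>f (fat_len m, y) - f (0, y)\<bar>"
    using assms(3) unfolding steep_rows_def by blast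
  let ?X = "fat_cantor \<inter> {0..fat_len m}" and ?Y = "fat_cantor \<inter> {0..fat_len k}"
  have cpt: "compact ?X" "compact ?Y"
    using compact_fat_cantor by (auto intro: compact_Int)
  define S where "S = (\<lambda>p. (f p, snd p)) ` (?X \<times> ?Y)"
  have "continuous_on (?X \<times> ?Y) f"
    by (rule continuous_on_subset[OF holder_on_imp_continuous_on[OF f]]) (use \<alpha> in auto)
  then have "compact S"
    unfolding S_def by (intro compact_continuous_image compact_Times cpt continuous_intros)
  then have S: "S \<in> sets (lborel \<Otimes>\<^sub>M lborel)"
    unfolding lborel_prod by (simp add: borel_closed compact_imp_closed)
  have row: "0 < emeasure lborel ((\<lambda>r. (r, y)) -` S)" if y: "y \<in> ?Y" for y
  proof -
    have "(\<lambda>r. (r, y)) -` S = (\<lambda>x. f (x, y)) ` ?X"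
      using y by (force simp: S_def image_iff)
    moreover have "holder_on 1 \<alpha> ?X (\<lambda>x. f (x, y))"
      unfolding holder_on_def
    proof (intro ballI)
      fix u v assume "u \<in> ?X" "v \<in> ?X"
      then show "\<bar>f (u, y) - f (v, y)\<bar> \<le> 1 * dist u v powr \<alpha>"
        using holder_onD[OF f, of "(u, y)" "(v, y)"] y by (simp add: dist_Pair_Pair)
    qed
    then have "0 < emeasure lborel ((\<lambda>x. f (x, y)) ` ?X)"
      using mkc(2) mkc(3)[OF y] by (intro holder_image_measure[OF \<alpha>]) auto
    ultimately show ?thesis by simp
  qed
  have pos: "emeasure (lborel \<Otimes>\<^sub>M lborel) S \<noteq> 0"
  proof
    assume "emeasure (lborel \<Otimes>\<^sub>M lborel) S = 0"
    then have "(\<integral>\<^sup>+ y. emeasure lborel ((\<lambda>r. (r, y)) -` S) \<partial>lborel) = 0"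
      using lborel_pair.emeasure_pair_measure_alt2[OF S] by simp
    then have "AE y in lborel. emeasure lborel ((\<lambda>r. (r, y)) -` S) = 0"
      using S by (subst (asm) nn_integral_0_iff_AE) (auto intro: lborel_pair.measurable_emeasure_Pair2)
    then have "AE y in lborel. y \<notin> ?Y"
      by eventually_elim (metis row less_irrefl)
    then have "emeasure lborel ?Y = 0"
      using compact_imp_closed[OF cpt(2)] by (subst (asm) AE_iff_measurable[of ?Y]) auto
    with fat_cantor_measure_pos[OF mkc(1)] show False by simp
  qed
  define R where "R = {r \<in> space lborel. 0 < emeasure lborel (Pair r -` S)}"
  have meas: "(\<lambda>r. emeasure lborel (Pair r -` S)) \<in> borel_measurable lborel"
    using S by (rule lborel.measurable_emeasure_Pair)
  then have R: "R \<in> sets lborel"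
    unfolding R_def by measurable
  have Rpos: "0 < emeasure lborel R"
  proof (rule ccontr)
    assume "\<not> 0 < emeasure lborel R"
    then have "R \<in> null_sets lborel"
      using R by (auto simp: null_sets_def)
    then have "AE r in lborel. r \<notin> R"
      by (rule AE_not_in)
    then have "AE r in lborel. emeasure lborel (Pair r -` S) = 0"
      by eventually_elim (simp add: R_def)
    then have "(\<integral>\<^sup>+ r. emeasure lborel (Pair r -` S) \<partial>lborel) = 0"
      using meas by (subst nn_integral_0_iff_AE) auto
    with pos show False
      using lborel.emeasure_pair_measure_alt[OF S] by simp
  qed
  have "ereal 1 \<le> D_lower_fun f (fat_cantor \<times> fat_cantor)"
  proof (rule D_lower_fun_geI[OF _ R Rpos])
    fix r assume "r \<in> R"
    then have "0 < emeasure lborel (Pair r -` S)"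
      by (simp add: R_def)
    moreover have "Pair r -` S \<subseteq> snd ` {x \<in> fat_cantor \<times> fat_cantor. f x = r}"
      by (force simp: S_def)
    moreover have "Pair r -` S \<in> sets lborel"
      using S by (rule sets_Pair1)
    ultimately show "ereal 1 \<le> level_dim f r (fat_cantor \<times> fat_cantor)"
      unfolding level_dim_def one_ereal_def[symmetric]
      by (intro hausdorff_dim_ge_1_if_projection[OF dist_snd_le])
  qed simp
  then show ?thesis by (simp add: one_ereal_def)
qed

lemma steep_rows_open:
  assumes "steep_rows \<alpha> f"
  shows "\<exists>\<delta>>0. \<forall>h. (\<forall>x\<in>fat_cantor \<times> fat_cantor. \<bar>h x - f x\<bar> < \<delta>) \<longrightarrow> steep_rows \<alpha> h"
proof -
  let ?A = "\<lambda>m. fat_len m powr (2 * \<alpha>) / (1 - 2 powr (1 - 2 * \<alpha>))"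
  obtain m k c where mkc: "1 \<le> k" "?A m < c"
      "\<And>y. y \<in> fat_cantor \<inter> {0..fat_len k} \<Longrightarrow> c \<le> \<bar>f (fat_len m, y) - f (0, y)\<bar>"
    using assms unfolding steep_rows_def by blast
  define \<delta> where "\<delta> = (c - ?A m) / 4"
  have "steep_rows \<alpha> h" if h: "\<forall>x\<in>fat_cantor \<times> fat_cantor. \<bar>h x - f x\<bar> < \<delta>" for h
    unfolding steep_rows_def
  proof (intro exI conjI ballI)
    show "1 \<le> k" by fact
    show "?A m < c - 2 * \<delta>"
      using mkc(2) unfolding \<delta>_def by argo
    fix y assume y: "y \<in> fat_cantor \<inter> {0..fat_len k}"
    then have "\<bar>h (fat_len m, y) - f (fat_len m, y)\<bar> < \<delta>" "\<bar>h (0, y) - f (0, y)\<bar> < \<delta>"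
      using h fat_len_in_fat_cantor zero_in_fat_cantor by auto
    with mkc(3)[OF y] show "c - 2 * \<delta> \<le> \<bar>h (fat_len m, y) - h (0, y)\<bar>"
      by linarith
  qed
  moreover have "\<delta> > 0"
    using mkc(2) by (simp add: \<delta>_def)
  ultimately show ?thesis by blast
qed

text \<open>
  Shrink \<open>f\<close> slightly and add \<open>\<plusminus>\<eta>x\<close>, where the sign agrees with that of the increment of \<open>f\<close> from
  \<open>(0, 0)\<close> to \<open>(l\<^sub>m, 0)\<close>. This makes the increment at least \<open>\<eta> l\<^sub>m\<close>, which for large \<open>m\<close> exceeds any
  multiple of \<open>l\<^sub>m\<^sup>2\<^sup>\<alpha>\<close>; by continuity the increment stays large in the rows near \<open>y = 0\<close>.
\<close>

lemma steep_rows_dense: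
  fixes f :: "real \<times> real \<Rightarrow> real"
  defines "F \<equiv> fat_cantor \<times> fat_cantor"
  assumes \<alpha>: "1/2 < \<alpha>" "\<alpha> \<le> 1" and f: "holder_on 1 \<alpha> F f" and "0 < \<epsilon>"
  shows "\<exists>h. holder_on 1 \<alpha> F h \<and> (\<forall>x\<in>F. \<bar>f x - h x\<bar> \<le> \<epsilon>) \<and> steep_rows \<alpha> h"
proof -
  let ?A = "\<lambda>m. fat_len m powr (2 * \<alpha>) / (1 - 2 powr (1 - 2 * \<alpha>))"
  have bF: "bounded F"
    using bounded_fat_cantor_square by (simp add: F_def)
  obtain B where B: "B > 0" "\<And>x. x \<in> F \<Longrightarrow> \<bar>f x\<bar> \<le> B"
    using holder_bounded[OF f bF] \<alpha> by auto
  define \<eta> where "\<eta> = min 1 (\<epsilon> / (B + 1))"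
  have \<eta>: "0 < \<eta>" "\<eta> \<le> 1" "\<eta> * (B + 1) \<le> \<epsilon>"
  proof -
    have "\<eta> \<le> \<epsilon> / (B + 1)"
      by (simp add: \<eta>_def)
    then show "\<eta> * (B + 1) \<le> \<epsilon>"
      using B(1) by (simp add: pos_le_divide_eq)
  qed (use \<open>0 < \<epsilon>\<close> B(1) in \<open>auto simp: \<eta>_def\<close>)
  have q: "2 powr (1 - 2 * \<alpha>) < 1"
    using \<alpha> by (simp add: powr_less_one)
  have "(\<lambda>m. fat_len m powr (2 * \<alpha> - 1) / (1 - 2 powr (1 - 2 * \<alpha>))) \<longlonglongrightarrow> 0 / (1 - 2 powr (1 - 2 * \<alpha>))"
    using \<alpha> q fat_len_tendsto_0 fat_len_pos
    by (intro tendsto_intros tendsto_zero_powrI[OF _ tendsto_const]) (auto simp: less_imp_le)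
  then have "\<forall>\<^sub>F m in sequentially. fat_len m powr (2 * \<alpha> - 1) / (1 - 2 powr (1 - 2 * \<alpha>)) < \<eta>"
    using \<eta>(1) by (intro order_tendstoD) auto
  then obtain m where "fat_len m powr (2 * \<alpha> - 1) / (1 - 2 powr (1 - 2 * \<alpha>)) < \<eta>"
    by (auto dest!: eventually_happens)
  then have "fat_len m powr (2 * \<alpha> - 1) / (1 - 2 powr (1 - 2 * \<alpha>)) * fat_len m < \<eta> * fat_len m"
    using fat_len_pos by (intro mult_strict_right_mono) auto
  moreover have "fat_len m powr (2 * \<alpha> - 1) * fat_len m = fat_len m powr (2 * \<alpha>)"
    using fat_len_pos[of m] by (simp add: powr_diff)
  ultimately have m: "?A m < \<eta> * fat_len m" by simp
  have "(\<lambda>k. 2 * fat_len k powr \<alpha>) \<longlonglongrightarrow> 2 * 0"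
    using \<alpha> fat_len_tendsto_0 fat_len_pos
    by (intro tendsto_intros tendsto_zero_powrI[OF _ tendsto_const]) (auto simp: less_imp_le)
  then have "\<forall>\<^sub>F k in sequentially. 2 * fat_len k powr \<alpha> < \<eta> * fat_len m - ?A m"
    by (rule order_tendstoD) (use m in simp)
  then have "\<forall>\<^sub>F k in sequentially. 1 \<le> k \<and> 2 * fat_len k powr \<alpha> < \<eta> * fat_len m - ?A m"
    by (intro eventually_conj eventually_ge_at_top)
  then obtain k where k: "1 \<le> k" "2 * fat_len k powr \<alpha> < \<eta> * fat_len m - ?A m"
    by (auto dest!: eventually_happens)
  define \<sigma> :: real where "\<sigma> = (if f (0, 0) \<le> f (fat_len m, 0) then 1 else -1)"
  define h where "h p = (1 - \<eta>) * f p + \<sigma> * \<eta> * fst p" for p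
  have F01: "fst p \<in> {0..1}" if "p \<in> F" for p
    using that fat_cantor_subset by (auto simp: F_def)
  have h: "holder_on 1 \<alpha> F h"
    unfolding holder_on_def
  proof (intro ballI)
    fix x y assume xy: "x \<in> F" "y \<in> F"
    have le1: "\<bar>fst x - fst y\<bar> \<le> 1"
      using F01[OF xy(1)] F01[OF xy(2)] by auto
    then have "\<bar>fst x - fst y\<bar> \<le> \<bar>fst x - fst y\<bar> powr \<alpha>"
      using powr_mono'[of \<alpha> 1 "\<bar>fst x - fst y\<bar>"] \<alpha> by simp
    also have "\<dots> \<le> dist x y powr \<alpha>"
      using dist_fst_le[of x y] \<alpha> by (intro powr_mono2) (auto simp: dist_real_def)
    finally have 1: "\<eta> * \<bar>fst x - fst y\<bar> \<le> \<eta> * dist x y powr \<alpha>"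
      using \<eta> by (intro mult_left_mono) auto
    have 2: "(1 - \<eta>) * \<bar>f x - f y\<bar> \<le> (1 - \<eta>) * dist x y powr \<alpha>"
      using holder_onD[OF f xy] \<eta> by (intro mult_left_mono) auto
    have "h x - h y = (1 - \<eta>) * (f x - f y) + \<sigma> * \<eta> * (fst x - fst y)"
      by (simp add: h_def algebra_simps)
    also have "\<bar>\<dots>\<bar> \<le> (1 - \<eta>) * \<bar>f x - f y\<bar> + \<eta> * \<bar>fst x - fst y\<bar>"
      using \<eta> by (intro order.trans[OF abs_triangle_ineq]) (auto simp: abs_mult \<sigma>_def)
    also have "\<dots> \<le> dist x y powr \<alpha>"
      using 1 2 by (simp add: algebra_simps)
    finally show "\<bar>h x - h y\<bar> \<le> 1 * dist x y powr \<alpha>" by simp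
  qed
  have "\<bar>f x - h x\<bar> \<le> \<epsilon>" if x: "x \<in> F" for x
  proof -
    have "f x - h x = \<eta> * f x - \<sigma> * \<eta> * fst x"
      by (simp add: h_def algebra_simps)
    also have "\<bar>\<dots>\<bar> \<le> \<eta> * \<bar>f x\<bar> + \<eta> * \<bar>fst x\<bar>"
      using \<eta> by (intro order.trans[OF abs_triangle_ineq4]) (auto simp: abs_mult \<sigma>_def)
    also have "\<dots> \<le> \<eta> * B + \<eta> * 1"
      using \<eta> B(2)[OF x] F01[OF x] by (intro add_mono mult_left_mono) auto
    also have "\<dots> \<le> \<epsilon>"
      using \<eta>(3) by (simp add: algebra_simps)
    finally show ?thesis .
  qed
  moreover have "steep_rows \<alpha> h"
    unfolding steep_rows_def
  proof (intro exI conjI ballI)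
    show "1 \<le> k" by fact
    show "?A m < \<eta> * fat_len m - 2 * fat_len k powr \<alpha>"
      using k(2) by linarith
    fix y assume y: "y \<in> fat_cantor \<inter> {0..fat_len k}"
    have vert: "\<bar>h (u, y) - h (u, 0)\<bar> \<le> fat_len k powr \<alpha>" if "u \<in> fat_cantor" for u
    proof -
      have "\<bar>h (u, y) - h (u, 0)\<bar> \<le> \<bar>y\<bar> powr \<alpha>"
        using holder_onD[OF h, of "(u, y)" "(u, 0)"] that y zero_in_fat_cantor
        by (simp add: F_def dist_Pair_Pair dist_real_def)
      also have "\<dots> \<le> fat_len k powr \<alpha>"
        using y \<alpha> by (intro powr_mono2) auto
      finally show ?thesis .
    qed
    have "\<eta> * fat_len m \<le> \<sigma> * (h (fat_len m, 0) - h (0, 0))"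
    proof -
      have "\<sigma> * (h (fat_len m, 0) - h (0, 0)) =
          (1 - \<eta>) * (\<sigma> * (f (fat_len m, 0) - f (0, 0))) + \<sigma> * \<sigma> * (\<eta> * fat_len m)"
        by (simp add: h_def algebra_simps)
      moreover have "0 \<le> (1 - \<eta>) * (\<sigma> * (f (fat_len m, 0) - f (0, 0)))" "\<sigma> * \<sigma> = 1"
        using \<eta> by (auto simp: \<sigma>_def intro!: mult_nonneg_nonneg)
      ultimately show ?thesis by simp
    qed
    also have "\<dots> \<le> \<bar>h (fat_len m, 0) - h (0, 0)\<bar>"
      unfolding \<sigma>_def by (cases "f (0, 0) \<le> f (fat_len m, 0)") simp_all
    finally show "\<eta> * fat_len m - 2 * fat_len k powr \<alpha> \<le> \<bar>h (fat_len m, y) - h (0, y)\<bar>"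
      using vert[OF fat_len_in_fat_cantor[of m]] vert[OF zero_in_fat_cantor] by linarith
  qed
  ultimately show ?thesis using h by blast
qed

lemma D_lower_ge_1:
  assumes \<alpha>: "1/2 < \<alpha>" "\<alpha> \<le> 1"
  shows "1 \<le> D_lower \<alpha> (fat_cantor \<times> fat_cantor)"
proof -
  let ?F = "fat_cantor \<times> fat_cantor"
  let ?G = "{f \<in> mspace (holder1_space \<alpha> ?F). steep_rows \<alpha> f}"
  have "?G \<in> dense_gdeltas \<alpha> ?F"
  proof (rule dense_open_in_dense_gdeltas)
    show "?F \<noteq> {}" using zero_in_fat_cantor by auto
    show "bounded ?F"
      by (rule bounded_fat_cantor_square)
    show "0 < \<alpha>" using \<alpha> by simp
    show "steep_rows \<alpha> g" if "\<And>x. x \<in> ?F \<Longrightarrow> f x = g x" "steep_rows \<alpha> f" for f g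
      using steep_rows_open[OF that(2)] that(1) by auto
    show "\<exists>\<delta>>0. \<forall>h. (\<forall>x\<in>?F. \<bar>h x - f x\<bar> < \<delta>) \<longrightarrow> steep_rows \<alpha> h" if "steep_rows \<alpha> f" for f
      using that by (rule steep_rows_open)
    show "\<exists>g. holder_on 1 \<alpha> ?F g \<and> (\<forall>x\<in>?F. \<bar>f x - g x\<bar> \<le> \<epsilon>) \<and> steep_rows \<alpha> g"
      if "holder_on 1 \<alpha> ?F f" "0 < \<epsilon>" for f \<epsilon>
      using steep_rows_dense[OF \<alpha> that] .
  qed
  moreover have "1 \<le> (INF f\<in>?G. D_lower_fun f ?F)"
    using \<alpha> by (intro INF_greatest steep_rows_D_lower_fun) (auto simp: mspace_holder1_space)
  ultimately show ?thesis
    unfolding D_lower_def using \<alpha> by (auto intro: SUP_upper2)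
qed

section \<open>Topological Hausdorff dimension\<close>

text \<open>
  The squares of all levels are relatively clopen in \<open>F\<close> and form a basis, so \<open>F\<close> has a basis of
  sets with empty boundary.
\<close>

lemma square_corner_preimage_clopen:
  "openin (top_of_set (fat_cantor \<times> fat_cantor)) {p \<in> fat_cantor \<times> fat_cantor. square_corner n p \<in> A}"
  "closedin (top_of_set (fat_cantor \<times> fat_cantor)) {p \<in> fat_cantor \<times> fat_cantor. square_corner n p \<in> A}"
proof -
  let ?F = "fat_cantor \<times> fat_cantor"
  have op: "openin (top_of_set ?F) {p \<in> ?F. square_corner n p \<in> A}" for A
    unfolding openin_euclidean_subtopology_iff
  proof (intro conjI ballI)
    fix p assume p: "p \<in> {p \<in> ?F. square_corner n p \<in> A}"
    have "square_corner n q = square_corner n p" if "q \<in> ?F" "dist q p < (fat_len n)\<^sup>2" for q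
    proof (rule ccontr)
      assume "square_corner n q \<noteq> square_corner n p"
      then have "(fat_len n)\<^sup>2 \<le> dist q p"
        using p that(1) by (intro distinct_squares_dist) auto
      with that(2) show False by simp
    qed
    then have "\<forall>q\<in>?F. dist q p < (fat_len n)\<^sup>2 \<longrightarrow> q \<in> {p \<in> ?F. square_corner n p \<in> A}"
      using p by simp
    moreover have "0 < (fat_len n)\<^sup>2"
      using fat_len_pos[of n] by simp
    ultimately show "\<exists>e>0. \<forall>q\<in>?F. dist q p < e \<longrightarrow> q \<in> {p \<in> ?F. square_corner n p \<in> A}"
      by blast
  qed auto
  show "openin (top_of_set ?F) {p \<in> ?F. square_corner n p \<in> A}"
    by (rule op)
  have "?F - {p \<in> ?F. square_corner n p \<in> A} = {p \<in> ?F. square_corner n p \<in> - A}"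
    by auto
  then show "closedin (top_of_set ?F) {p \<in> ?F. square_corner n p \<in> A}"
    using op[of "- A"] by (auto simp: closedin_def)
qed

lemma tH_dim_le_0: "tH_dim (fat_cantor \<times> fat_cantor) \<le> 0"
proof -
  let ?F = "fat_cantor \<times> fat_cantor"
  let ?V = "\<lambda>n q. {p \<in> ?F. square_corner n p \<in> {q}}"
  define \<U> where "\<U> = {?V n q | n q. True}"
  have basis: "openin (top_of_set ?F) = arbitrary union_of (\<lambda>U. U \<in> \<U>)"
    unfolding openin_topology_base_unique
  proof (intro conjI allI impI)
    show "openin (top_of_set ?F) V" if "V \<in> \<U>" for V
      using that square_corner_preimage_clopen(1) unfolding \<U>_def by blast
    fix U x assume U: "openin (top_of_set ?F) U \<and> x \<in> U"
    then have x: "x \<in> ?F"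
      using openin_imp_subset by blast
    from U obtain e where e: "e > 0" "\<And>y. y \<in> ?F \<Longrightarrow> dist y x < e \<Longrightarrow> y \<in> U"
      unfolding openin_euclidean_subtopology_iff by blast
    have "\<forall>\<^sub>F n in sequentially. fat_len n < e / 4"
      using fat_len_tendsto_0 e(1) by (intro order_tendstoD) auto
    then obtain n where n: "fat_len n < e / 4"
      by (auto dest!: eventually_happens)
    have "?V n (square_corner n x) \<subseteq> U"
    proof
      fix y assume y: "y \<in> ?V n (square_corner n x)"
      then have "y \<in> ?F" "square_corner n y = square_corner n x"
        by blast+
      then have "dist y x \<le> 4 * fat_len n"
        using square_corner_dist[of y n] square_corner_dist[OF x, of n]
          dist_triangle2[of y x "square_corner n x"] by simp
      with n \<open>y \<in> ?F\<close> show "y \<in> U"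
        by (intro e(2)) auto
    qed
    moreover have "x \<in> ?V n (square_corner n x)"
      using x by blast
    ultimately show "\<exists>V. V \<in> \<U> \<and> x \<in> V \<and> V \<subseteq> U"
      unfolding \<U>_def by blast
  qed
  have "top_of_set ?F frontier_of U = {}" if "U \<in> \<U>" for U
  proof -
    have "openin (top_of_set ?F) U \<and> closedin (top_of_set ?F) U"
      using that square_corner_preimage_clopen unfolding \<U>_def by blast
    then show ?thesis
      using clopenin_eq_frontier_of[of "top_of_set ?F" U] by blast
  qed
  then have front: "\<forall>U\<in>\<U>. (let B = top_of_set ?F frontier_of U
      in (if B = {} then -1 else hausdorff_dim B) \<le> ereal (0 - 1))"
    by (simp add: Let_def one_ereal_def)
  have "?F \<noteq> {}"
    using zero_in_fat_cantor by blast
  have "tH_dim ?F \<le> ereal 0"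
    unfolding tH_dim_def if_not_P[OF \<open>?F \<noteq> {}\<close>]
    by (rule Inf_lower) (use basis front in blast)
  then show ?thesis by (simp add: zero_ereal_def)
qed

section \<open>The phase transition\<close>

theorem theorem6p1:
  fixes F :: "(real \<times> real) set"
  assumes "F = fat_cantor \<times> fat_cantor"
  shows "admits_phase_transition F \<and>
         (\<forall>\<alpha>. 0 < \<alpha> \<and> \<alpha> < 1/2 \<longrightarrow> D_lower \<alpha> F = 0) \<and>
         (\<forall>\<alpha>. 1/2 < \<alpha> \<and> \<alpha> \<le> 1 \<longrightarrow> D_lower \<alpha> F = 1)"
proof -
  have "tH_dim F - 1 \<le> 0"
    using tH_dim_le_0 unfolding assms
    by (cases "tH_dim (fat_cantor \<times> fat_cantor)") (auto simp: one_ereal_def zero_ereal_def)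
  then have zero: "D_lower 0 F = 0"
    by (simp add: D_lower_def)
  have small: "D_lower \<alpha> F = 0" if "0 < \<alpha>" "\<alpha> < 1/2" for \<alpha>
    using D_lower_eq_0[OF that] assms by simp
  have large: "D_lower \<alpha> F = 1" if "1/2 < \<alpha>" "\<alpha> \<le> 1" for \<alpha>
  proof (rule antisym)
    show "D_lower \<alpha> F \<le> 1"
      using that fat_cantor_subset zero_in_fat_cantor unfolding assms
      by (intro D_lower_le_1) auto
    show "1 \<le> D_lower \<alpha> F"
      using D_lower_ge_1[OF that] assms by simp
  qed
  have "admits_phase_transition F"
    unfolding admits_phase_transition_def
  proof (intro exI[of _ "1/2"] conjI allI impI)
    show "D_lower \<alpha> F = D_lower 0 F" if "0 \<le> \<alpha> \<and> \<alpha> < 1/2" for \<alpha>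
      using small[of \<alpha>] zero that by (cases "\<alpha> = 0") auto
    show "D_lower 0 F < D_lower \<alpha> F" if "1/2 < \<alpha> \<and> \<alpha> \<le> 1" for \<alpha>
      using large[of \<alpha>] zero that by simp
  qed auto
  with small large show ?thesis by blast
qed

end
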